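(* Let $\lambda=\lambda_{p,D}$ be the missing digits measure on $\mathbb{R}$ with base $p=10^{10000}$ and digit set $D=\{1,2,\dots,10^{8000}\}$. Then for each $x\in\mathbb{R}^2$ with $x\notin \mathrm{supp}(\lambda)\times\mathrm{supp}(\lambda)$, the radial projection $\Pi_x(\lambda\times\lambda)$ is absolutely continuous (with respect to Lebesgue measure on $S^1$) with a density function in $L^2(S^1)$.
   Context: Missing digits measure: for an integer $p\ge 3$ and a non-empty set $D\subset\{0,\dots,p-1\}$, $\lambda_{p,D}$ is the Borel probability measure on $\mathbb{R}$ that is the distribution of the random sum $S=\sum_{i\ge 1}p^{-i}\mathbf{d}_i$, where the $\mathbf{d}_i$ are chosen independently and uniformly at random from $D$ (each element having probability $1/\#D$). Radial projection: for $x\in\mathbb{R}^n$ let $\Pi_x:\mathbb{R}^n\setminus\{x\}\to S^{n-1}$, $\Pi_x(y)=\frac{y-x}{|y-x|}$. For a compactly supported Borel probability measure $\mu$ on $\mathbb{R}^n$ and $x\notin\mathrm{supp}(\mu)$, $\Pi_x(\mu)$ denotes the push-forward of $\mu$ under $\Pi_x$, a Borel probability measure on $S^{n-1}$. Here $n=2$, $\mu=\lambda\times\lambda$ is the product measure, and $S^1$ is the unit circle with its Lebesgue (arc-length) measure. *)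

theory Defs
  imports "HOL-Probability.Probability"
begin

(* The coordinate i of the sample sequence carries the weight p^(-(i+1)), since sequences
   are indexed from 0 here. *)
definition missing_digits_measure :: "nat \<Rightarrow> nat set \<Rightarrow> real measure" where
  "missing_digits_measure p D =
     distr (\<Pi>\<^sub>M i\<in>(UNIV :: nat set). uniform_count_measure D) borel
       (\<lambda>d. \<Sum>i. real (d i) / real p ^ Suc i)"

definition measure_support :: "'a::topological_space measure \<Rightarrow> 'a set" where
  "measure_support M = {x. \<forall>U. open U \<longrightarrow> x \<in> U \<longrightarrow> emeasure M U > 0}"

definition radial_projection :: "'a::euclidean_space \<Rightarrow> 'a \<Rightarrow> 'a" where
  "radial_projection x y = (y - x) /\<^sub>R norm (y - x)"

(* The radial projection is only defined off x, hence the restriction to the complement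
   of {x}; if x is not in the support of M, no mass is lost. *)
definition radial_pushforward :: "'a::euclidean_space \<Rightarrow> 'a measure \<Rightarrow> 'a measure" where
  "radial_pushforward x M =
     distr (restrict_space M (- {x})) (restrict_space borel (sphere 0 1)) (radial_projection x)"

(* Lebesgue (arc-length) measure on the unit circle of the Euclidean plane, as the image of
   Lebesgue measure on [0, 2 pi) under the unit-speed parametrisation. Total mass 2 pi. *)
definition circle_measure :: "(real \<times> real) measure" where
  "circle_measure =
     distr (restrict_space lborel {0..<2 * pi}) (restrict_space borel (sphere 0 1))
       (\<lambda>t. (cos t, sin t))"

lemma sets_missing_digits_measure [simp]: "sets (missing_digits_measure p D) = sets borel"
  by (simp add: missing_digits_measure_def)

lemma space_missing_digits_measure [simp]: "space (missing_digits_measure p D) = UNIV"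
  by (simp add: missing_digits_measure_def)

lemma prob_space_missing_digits_measure:
  assumes "finite D" "D \<noteq> {}"
  shows "prob_space (missing_digits_measure p D)"
proof -
  interpret product_prob_space "\<lambda>i::nat. uniform_count_measure D" UNIV
    using assms
    by (intro product_prob_spaceI prob_space_uniform_count_measure)
  have comp: "(\<lambda>d. real (d i)) \<in> borel_measurable (\<Pi>\<^sub>M i\<in>(UNIV :: nat set). uniform_count_measure D)"
    for i
  proof -
    have "real \<in> borel_measurable (uniform_count_measure D)"
      by (auto simp: measurable_def space_uniform_count_measure sets_uniform_count_measure)
    then show ?thesis
      by (rule measurable_compose[rotated]) (rule measurable_component_singleton, simp)
  qed
  show ?thesis
    unfolding missing_digits_measure_def
    by (intro prob_space_distr borel_measurable_suminf borel_measurable_divide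
        borel_measurable_const comp)
qed

lemma measurable_radial_projection:
  fixes M :: "'a::euclidean_space measure"
  assumes "sets M = sets borel"
  shows "radial_projection x \<in>
    restrict_space M (- {x}) \<rightarrow>\<^sub>M restrict_space borel (sphere 0 1)"
proof (rule measurable_restrict_space2)
  show "radial_projection x \<in> space (restrict_space M (- {x})) \<rightarrow> sphere 0 1"
    by (auto simp: space_restrict_space radial_projection_def)
  have "radial_projection x \<in> borel_measurable borel"
    unfolding radial_projection_def by measurable
  then show "radial_projection x \<in> borel_measurable (restrict_space M (- {x}))"
    using assms by (intro measurable_restrict_space1) (simp cong: measurable_cong_sets)
qed

lemma prob_space_radial_pushforward:
  fixes M :: "'a::euclidean_space measure"
  assumes "prob_space M" and M: "sets M = sets borel" and "x \<notin> measure_support M"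
  shows "prob_space (radial_pushforward x M)"
proof -
  interpret prob_space M by fact
  obtain U where U: "open U" "x \<in> U" "emeasure M U = 0"
    using assms(3) by (auto simp: measure_support_def)
  have null: "emeasure M {x} = 0"
    using emeasure_mono[of "{x}" U M] U M by auto
  have "space M = UNIV"
    using sets_eq_imp_space_eq[OF M] by simp
  then have "emeasure M (- {x}) = 1"
    using emeasure_Diff[of M "{x}" UNIV] null M emeasure_space_1 by (simp add: Compl_eq_Diff_UNIV)
  then have "prob_space (restrict_space M (- {x}))"
    using M \<open>space M = UNIV\<close>
    by (intro prob_spaceI) (simp add: emeasure_restrict_space space_restrict_space)
  then show ?thesis
    unfolding radial_pushforward_def
    by (intro prob_space.prob_space_distr measurable_radial_projection M)
qed

lemma measurable_circle_parametrisation: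
  "(\<lambda>t. (cos t, sin t)) \<in>
     restrict_space lborel {0..<2 * pi} \<rightarrow>\<^sub>M restrict_space borel (sphere (0 :: real \<times> real) 1)"
proof (rule measurable_restrict_space2)
  show "(\<lambda>t. (cos t, sin t)) \<in> space (restrict_space lborel {0..<2 * pi}) \<rightarrow>
      sphere (0 :: real \<times> real) 1"
    by (auto simp: norm_Pair)
  have "continuous_on UNIV (\<lambda>t::real. (cos t, sin t))"
    by (intro continuous_intros)
  then have "(\<lambda>t::real. (cos t, sin t)) \<in> borel_measurable borel"
    by (rule borel_measurable_continuous_onI)
  then show "(\<lambda>t. (cos t, sin t)) \<in> borel_measurable (restrict_space lborel {0..<2 * pi})"
    by (intro measurable_restrict_space1) simp
qed

lemma emeasure_circle_measure: "emeasure circle_measure (sphere 0 1) = ennreal (2 * pi)"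
proof -
  have "(\<lambda>t. (cos t, sin t)) -` sphere (0 :: real \<times> real) 1 = (UNIV :: real set)"
    by (auto simp: norm_Pair)
  moreover have "sphere 0 1 \<in> sets (restrict_space borel (sphere (0 :: real \<times> real) 1))"
    using sets.top[of "restrict_space borel (sphere (0 :: real \<times> real) 1)"]
    by (simp add: space_restrict_space)
  ultimately show ?thesis
    unfolding circle_measure_def
    by (simp add: emeasure_distr measurable_circle_parametrisation emeasure_restrict_space
        space_restrict_space)
qed

end

theory Submission
  imports Defs
begin

text \<open>
The idea is to bound the mass that \<open>\<lambda> \<times> \<lambda>\<close> gives to a thin strip around a line through \<open>x\<close> by a
Fourier integral that does not depend on the width of the strip, and to show that this integral is
a square integrable function of the direction of the line.

Let \<open>\<psi>\<close> be the modulus of the characteristic function of \<open>\<lambda>\<close>. The distance of a random point to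
a line of direction \<open>(cos t, sin t)\<close> is a linear form in two independent coordinates, hence Gaussian
smoothing gives the strip of half-width \<open>r\<close> a mass of at most \<open>r * G t\<close>, with \<open>G t\<close> the integral
of \<open>\<psi> (\<tau> * cos t) * \<psi> (\<tau> * sin t)\<close> over all real \<open>\<tau>\<close> (lemma \<open>emeasure_strip_le\<close>). Points seen
from \<open>x\<close> in a short arc of directions lie in a thin strip for each direction of the arc; averaging
over these directions, the projection is dominated by a constant multiple of \<open>G\<close> as a measure on
the circle (lemma \<open>radial_pushforward_le\<close>). It remains to see that \<open>G\<close> is square integrable; the
Radon-Nikodym density is then square integrable as well.

For individual directions \<open>G\<close> may be infinite, because linear projections of \<open>\<lambda> \<times> \<lambda>\<close> along
special slopes are singular. On average over the direction it is small. Suppose that \<open>\<psi>\<close> has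
integral at most a constant times \<open>A ^ k\<close> over frequencies up to \<open>p ^ k\<close>. Write \<open>G\<^sup>2\<close> as a double
integral over two frequencies and retain the dependence on the slope only at the larger one, where
the average over slopes produces another integral of \<open>\<psi>\<close>, divided by the frequency. The
contribution of frequencies near \<open>p ^ k\<close> is then about \<open>A ^ (3 * k) / p ^ k\<close>, which is summable if
\<open>A ^ 3 < p\<close> (lemma \<open>slope_integral_finite\<close>).

The growth rate \<open>A\<close> comes from the product structure of the characteristic function: \<open>\<psi> t\<close> is
bounded by a product of normalised Dirichlet kernels at the points \<open>t / p ^ i\<close>, and peeling off one
factor at a time shows that \<open>A\<close> may be taken as the largest sum of the moduli of one such kernel
over a grid of mesh \<open>2 * pi / p\<close> (lemma \<open>nn_integral_riesz_product_le\<close>). For \<open>N\<close> consecutive digits this is of order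
\<open>(p / N) * ln p\<close>. With \<open>p = 10 ^ 10000\<close> and \<open>N = 10 ^ 8000\<close> it is close to \<open>10 ^ 2000\<close>, far
below the cube root of \<open>p\<close>.
\<close>

section \<open>Square integrability of integrals along lines, in terms of the slope\<close>

text \<open>The square of an integral is a double integral over pairs \<open>(a, b)\<close>; by symmetry the pairs with
\<open>\<bar>b\<bar> \<le> \<bar>a\<bar>\<close> carry at least half of it.\<close>

lemma nn_integral_square_le_ordered:
  fixes g :: "real \<Rightarrow> ennreal"
  assumes [measurable]: "g \<in> borel_measurable borel"
  shows "(\<integral>\<^sup>+a. g a \<partial>lborel)\<^sup>2 \<le>
    2 * (\<integral>\<^sup>+a. g a * (\<integral>\<^sup>+b. g b * indicator {b. \<bar>b\<bar> \<le> \<bar>a\<bar>} b \<partial>lborel) \<partial>lborel)"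
    (is "_ \<le> 2 * ?R")
proof -
  have "(\<integral>\<^sup>+a. g a \<partial>lborel)\<^sup>2 = (\<integral>\<^sup>+a. \<integral>\<^sup>+b. g a * g b \<partial>lborel \<partial>lborel)"
    by (simp add: power2_eq_square nn_integral_cmult nn_integral_multc)
  also have "\<dots> \<le> (\<integral>\<^sup>+a. \<integral>\<^sup>+b. g a * g b * indicator {b. \<bar>b\<bar> \<le> \<bar>a\<bar>} b +
      g a * g b * indicator {a. \<bar>a\<bar> \<le> \<bar>b\<bar>} a \<partial>lborel \<partial>lborel)"
    by (intro nn_integral_mono) (auto split: split_indicator)
  also have "\<dots> = (\<integral>\<^sup>+a. \<integral>\<^sup>+b. g a * g b * indicator {b. \<bar>b\<bar> \<le> \<bar>a\<bar>} b \<partial>lborel \<partial>lborel) +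
      (\<integral>\<^sup>+a. \<integral>\<^sup>+b. g a * g b * indicator {a. \<bar>a\<bar> \<le> \<bar>b\<bar>} a \<partial>lborel \<partial>lborel)"
    by (simp add: nn_integral_add)
  also have "(\<integral>\<^sup>+a. \<integral>\<^sup>+b. g a * g b * indicator {a. \<bar>a\<bar> \<le> \<bar>b\<bar>} a \<partial>lborel \<partial>lborel) =
      (\<integral>\<^sup>+b. \<integral>\<^sup>+a. g a * g b * indicator {a. \<bar>a\<bar> \<le> \<bar>b\<bar>} a \<partial>lborel \<partial>lborel)"
    by (subst lborel_pair.Fubini') auto
  also have "\<dots> = ?R"
    by (simp add: nn_integral_cmult[symmetric] mult_ac)
  also have "(\<integral>\<^sup>+a. \<integral>\<^sup>+b. g a * g b * indicator {b. \<bar>b\<bar> \<le> \<bar>a\<bar>} b \<partial>lborel \<partial>lborel) = ?R"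
    by (simp add: nn_integral_cmult[symmetric] mult_ac)
  finally show ?thesis by (simp add: mult_2)
qed

lemma nn_integral_dilate:
  fixes h :: "real \<Rightarrow> ennreal"
  assumes [measurable]: "h \<in> borel_measurable borel" and "\<eta> \<noteq> 0"
  shows "(\<integral>\<^sup>+s. h (s * \<eta>) * indicator {-1..1} s \<partial>lborel) =
    (\<integral>\<^sup>+t. h t * indicator {t. \<bar>t\<bar> \<le> \<bar>\<eta>\<bar>} t \<partial>lborel) / ennreal \<bar>\<eta>\<bar>"
proof -
  have "(\<integral>\<^sup>+t. h t * indicator {t. \<bar>t\<bar> \<le> \<bar>\<eta>\<bar>} t \<partial>lborel) =
     ennreal \<bar>\<eta>\<bar> * (\<integral>\<^sup>+s. h (0 + \<eta> * s) * indicator {t. \<bar>t\<bar> \<le> \<bar>\<eta>\<bar>} (0 + \<eta> * s) \<partial>lborel)"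
    using assms by (intro nn_integral_real_affine) auto
  also have "(\<lambda>s. h (0 + \<eta> * s) * indicator {t. \<bar>t\<bar> \<le> \<bar>\<eta>\<bar>} (0 + \<eta> * s)) =
      (\<lambda>s. h (s * \<eta>) * indicator {-1..1} s)"
  proof
    fix s
    have "\<bar>\<eta> * s\<bar> \<le> \<bar>\<eta>\<bar> \<longleftrightarrow> s \<in> {-1..1}"
      using assms(2) by (auto simp: abs_mult mult_le_cancel_left1 abs_le_iff)
    then show "h (0 + \<eta> * s) * indicator {t. \<bar>t\<bar> \<le> \<bar>\<eta>\<bar>} (0 + \<eta> * s) =
        h (s * \<eta>) * indicator {-1..1} s"
      by (simp add: indicator_def mult.commute)
  qed
  finally show ?thesis
    using assms(2) by (simp add: ennreal_mult_divide_eq mult.commute[of "ennreal \<bar>\<eta>\<bar>"])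
qed

text \<open>Among the two frequencies of the squared integral only the larger one, \<open>\<eta>\<close>, keeps its factor
\<open>h (s * \<eta>)\<close>, which is then averaged over the slope \<open>s\<close>. The smaller one contributes at most the
growth function \<open>\<Phi>\<close>, because \<open>h \<le> 1\<close>.\<close>

lemma slope_integral_le:
  fixes h :: "real \<Rightarrow> ennreal"
  assumes [measurable]: "h \<in> borel_measurable borel" and h1: "\<And>t. h t \<le> 1"
  defines "\<Phi> \<equiv> \<lambda>\<eta>. \<integral>\<^sup>+t. h t * indicator {t. \<bar>t\<bar> \<le> \<bar>\<eta>\<bar>} t \<partial>lborel"
  shows "(\<integral>\<^sup>+s. (\<integral>\<^sup>+\<eta>. h \<eta> * h (s * \<eta>) \<partial>lborel)\<^sup>2 * indicator {-1..1} s \<partial>lborel) \<le>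
    2 * (\<integral>\<^sup>+\<eta>. h \<eta> * \<Phi> \<eta> * (\<integral>\<^sup>+s. h (s * \<eta>) * indicator {-1..1} s \<partial>lborel) \<partial>lborel)"
proof -
  have [measurable]: "\<Phi> \<in> borel_measurable borel"
    unfolding \<Phi>_def by measurable
  have "(\<integral>\<^sup>+\<eta>. h \<eta> * h (s * \<eta>) \<partial>lborel)\<^sup>2 \<le> 2 * (\<integral>\<^sup>+\<eta>. h \<eta> * \<Phi> \<eta> * h (s * \<eta>) \<partial>lborel)" for s
  proof -
    have "(\<integral>\<^sup>+\<eta>. h \<eta> * h (s * \<eta>) \<partial>lborel)\<^sup>2 \<le>
      2 * (\<integral>\<^sup>+a. h a * h (s * a) *
        (\<integral>\<^sup>+b. (h b * h (s * b)) * indicator {b. \<bar>b\<bar> \<le> \<bar>a\<bar>} b \<partial>lborel) \<partial>lborel)"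
      by (rule nn_integral_square_le_ordered) measurable
    also have "\<dots> \<le> 2 * (\<integral>\<^sup>+a. h a * h (s * a) * \<Phi> a \<partial>lborel)"
      unfolding \<Phi>_def
      by (intro mult_left_mono nn_integral_mono mult_right_mono) (auto intro: mult_left_le h1)
    finally show ?thesis by (simp add: mult_ac)
  qed
  then have "(\<integral>\<^sup>+s. (\<integral>\<^sup>+\<eta>. h \<eta> * h (s * \<eta>) \<partial>lborel)\<^sup>2 * indicator {-1..1} s \<partial>lborel) \<le>
      (\<integral>\<^sup>+s. 2 * (\<integral>\<^sup>+\<eta>. h \<eta> * \<Phi> \<eta> * h (s * \<eta>) \<partial>lborel) * indicator {-1..1} s \<partial>lborel)"
    by (intro nn_integral_mono mult_right_mono) auto
  also have "\<dots> = 2 * (\<integral>\<^sup>+s. \<integral>\<^sup>+\<eta>. h \<eta> * \<Phi> \<eta> * h (s * \<eta>) * indicator {-1..1} s \<partial>lborel \<partial>lborel)"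
    by (simp add: nn_integral_cmult[symmetric] nn_integral_multc[symmetric] mult.assoc)
  also have "(\<integral>\<^sup>+s. \<integral>\<^sup>+\<eta>. h \<eta> * \<Phi> \<eta> * h (s * \<eta>) * indicator {-1..1} s \<partial>lborel \<partial>lborel) =
      (\<integral>\<^sup>+\<eta>. \<integral>\<^sup>+s. h \<eta> * \<Phi> \<eta> * h (s * \<eta>) * indicator {-1..1} s \<partial>lborel \<partial>lborel)"
    by (subst lborel_pair.Fubini') auto
  also have "\<dots> = (\<integral>\<^sup>+\<eta>. h \<eta> * \<Phi> \<eta> * (\<integral>\<^sup>+s. h (s * \<eta>) * indicator {-1..1} s \<partial>lborel) \<partial>lborel)"
    by (simp add: nn_integral_cmult[symmetric] mult.assoc)
  finally show ?thesis .
qed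

text \<open>Averaging \<open>h (s * \<eta>)\<close> over \<open>\<bar>s\<bar> \<le> 1\<close> gives \<open>\<Phi> \<eta> / \<bar>\<eta>\<bar>\<close>, so the integrand of the previous bound is
\<open>h \<eta> * (\<Phi> \<eta>)\<^sup>2 / \<bar>\<eta>\<bar>\<close>. On the shell of radius about \<open>p ^ k\<close> each of the three factors of \<open>h\<close> costs
a factor \<open>A ^ k\<close> and the division by \<open>\<bar>\<eta>\<bar>\<close> gains \<open>p ^ k\<close>: the shells sum to a geometric series of
ratio \<open>A ^ 3 / p\<close>. This is where the condition \<open>A ^ 3 < p\<close> comes from.\<close>

lemma slope_integral_finite:
  fixes h :: "real \<Rightarrow> ennreal" and A C c p :: real
  assumes [measurable]: "h \<in> borel_measurable borel" and h1: "\<And>t. h t \<le> 1"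
    and pos: "0 \<le> A" "0 \<le> C" "0 < c" "1 < p" and A3: "A ^ 3 < p"
    and bound: "\<And>k. (\<integral>\<^sup>+t. h t * indicator {t. \<bar>t\<bar> \<le> c * p ^ k} t \<partial>lborel) \<le> ennreal (C * A ^ k)"
  shows "(\<integral>\<^sup>+s. (\<integral>\<^sup>+\<eta>. h \<eta> * h (s * \<eta>) \<partial>lborel)\<^sup>2 * indicator {-1..1} s \<partial>lborel) < \<infinity>"
proof -
  define \<Phi> where "\<Phi> \<eta> = (\<integral>\<^sup>+t. h t * indicator {t. \<bar>t\<bar> \<le> \<bar>\<eta>\<bar>} t \<partial>lborel)" for \<eta>
  define J where "J \<eta> = (\<integral>\<^sup>+s. h (s * \<eta>) * indicator {-1..1} s \<partial>lborel)" for \<eta>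
  \<comment> \<open>The shell of index 0 contains the origin, where the slope average is only bounded by 2.\<close>
  define b where "b k = (if k = 0 then 2 * C else (C * A ^ k)\<^sup>2 / (c * p ^ (k - 1)))" for k :: nat
  have b0: "0 \<le> b k" for k
    using pos by (auto simp: b_def)
  have \<Phi>_le: "\<Phi> \<eta> \<le> ennreal (C * A ^ k)" if "\<bar>\<eta>\<bar> \<le> c * p ^ k" for \<eta> k
    unfolding \<Phi>_def using that
    by (intro order_trans[OF nn_integral_mono bound]) (auto split: split_indicator)
  have J_le2: "J \<eta> \<le> 2" for \<eta>
  proof -
    have "J \<eta> \<le> (\<integral>\<^sup>+s. indicator {-1..1::real} s \<partial>lborel)"
      unfolding J_def by (intro nn_integral_mono) (auto split: split_indicator intro: h1)
    then show ?thesis by simp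
  qed
  have pointwise: "\<exists>k. \<Phi> \<eta> * J \<eta> \<le> ennreal (b k) \<and> \<bar>\<eta>\<bar> \<le> c * p ^ k" for \<eta>
  proof -
    define k where "k = (LEAST k. \<bar>\<eta>\<bar> \<le> c * p ^ k)"
    obtain n where "\<bar>\<eta>\<bar> / c < p ^ n"
      using real_arch_pow[OF \<open>1 < p\<close>] by blast
    then have "\<bar>\<eta>\<bar> \<le> c * p ^ n"
      using pos by (simp add: field_simps)
    then have k: "\<bar>\<eta>\<bar> \<le> c * p ^ k"
      unfolding k_def by (rule LeastI)
    show ?thesis
    proof (cases "k = 0")
      case True
      have "\<Phi> \<eta> * J \<eta> \<le> ennreal C * 2"
        using \<Phi>_le[OF k] J_le2 True by (intro mult_mono) auto
      then show ?thesis
        using k True pos by (intro exI[of _ k]) (simp add: b_def ennreal_mult mult.commute)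
    next
      case False
      then have "\<not> \<bar>\<eta>\<bar> \<le> c * p ^ (k - 1)"
        unfolding k_def by (intro not_less_Least) (auto simp: k_def)
      then have big: "c * p ^ (k - 1) < \<bar>\<eta>\<bar>" by simp
      have cp: "0 < c * p ^ (k - 1)" using pos by simp
      have "\<eta> \<noteq> 0" using big cp by auto
      have "\<Phi> \<eta> * J \<eta> = \<Phi> \<eta> * (\<Phi> \<eta> / ennreal \<bar>\<eta>\<bar>)"
        unfolding J_def nn_integral_dilate[OF assms(1) \<open>\<eta> \<noteq> 0\<close>] \<Phi>_def ..
      also have "\<dots> \<le> ennreal (C * A ^ k) * (ennreal (C * A ^ k) / ennreal (c * p ^ (k - 1)))"
        using big cp unfolding divide_ennreal_def
        by (intro mult_mono \<Phi>_le[OF k]) (auto simp: inverse_ennreal simp del: inverse_mult_distrib intro!: ennreal_leI le_imp_inverse_le)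
      also have "\<dots> = ennreal (b k)"
        using pos False by (simp add: b_def divide_ennreal ennreal_mult[symmetric] power2_eq_square)
      finally show ?thesis using k by auto
    qed
  qed
  have "h \<eta> * \<Phi> \<eta> * J \<eta> \<le> (\<Sum>k. ennreal (b k) * (h \<eta> * indicator {t. \<bar>t\<bar> \<le> c * p ^ k} \<eta>))" for \<eta>
  proof -
    obtain k where k: "\<Phi> \<eta> * J \<eta> \<le> ennreal (b k)" "\<bar>\<eta>\<bar> \<le> c * p ^ k"
      using pointwise by blast
    have "h \<eta> * \<Phi> \<eta> * J \<eta> \<le> h \<eta> * ennreal (b k)"
      using k by (simp add: mult.assoc mult_left_mono)
    also have "\<dots> = sum (\<lambda>k. ennreal (b k) * (h \<eta> * indicator {t. \<bar>t\<bar> \<le> c * p ^ k} \<eta>)) {k}"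
      using k by (simp add: mult.commute)
    also have "\<dots> \<le> (\<Sum>k. ennreal (b k) * (h \<eta> * indicator {t. \<bar>t\<bar> \<le> c * p ^ k} \<eta>))"
      by (intro sum_le_suminf) auto
    finally show ?thesis .
  qed
  then have "(\<integral>\<^sup>+\<eta>. h \<eta> * \<Phi> \<eta> * J \<eta> \<partial>lborel) \<le>
      (\<integral>\<^sup>+\<eta>. (\<Sum>k. ennreal (b k) * (h \<eta> * indicator {t. \<bar>t\<bar> \<le> c * p ^ k} \<eta>)) \<partial>lborel)"
    by (intro nn_integral_mono) auto
  also have "\<dots> = (\<Sum>k. ennreal (b k) * (\<integral>\<^sup>+\<eta>. h \<eta> * indicator {t. \<bar>t\<bar> \<le> c * p ^ k} \<eta> \<partial>lborel))"
    by (subst nn_integral_suminf) (auto simp: nn_integral_cmult)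
  also have "\<dots> \<le> (\<Sum>k. ennreal (b k * (C * A ^ k)))"
  proof (intro suminf_le)
    fix k
    show "ennreal (b k) * (\<integral>\<^sup>+\<eta>. h \<eta> * indicator {t. \<bar>t\<bar> \<le> c * p ^ k} \<eta> \<partial>lborel) \<le>
        ennreal (b k * (C * A ^ k))"
      unfolding ennreal_mult'[OF b0] by (intro mult_left_mono bound) simp
  qed auto
  also have "\<dots> < \<infinity>"
  proof -
    have "summable (\<lambda>k. C ^ 3 * p / c * (A ^ 3 / p) ^ k)"
      using pos A3 by (intro summable_mult summable_geometric) (simp add: abs_mult)
    then have "summable (\<lambda>k. C ^ 3 * p / c * (A ^ 3 / p) ^ Suc k)"
      by (subst summable_Suc_iff)
    also have "(\<lambda>k. C ^ 3 * p / c * (A ^ 3 / p) ^ Suc k) = (\<lambda>k. b (Suc k) * (C * A ^ Suc k))"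
      using pos by (auto simp: fun_eq_iff b_def field_simps power2_eq_square power3_eq_cube power_mult_distrib)
    finally have "summable (\<lambda>k. b k * (C * A ^ k))"
      by (subst (asm) summable_Suc_iff)
    then show ?thesis
      using pos b0 by (subst suminf_ennreal2) auto
  qed
  finally have "(\<integral>\<^sup>+\<eta>. h \<eta> * \<Phi> \<eta> * J \<eta> \<partial>lborel) < \<infinity>" .
  then have "2 * (\<integral>\<^sup>+\<eta>. h \<eta> * \<Phi> \<eta> * J \<eta> \<partial>lborel) < \<infinity>"
    by (simp add: ennreal_mult_less_top)
  then show ?thesis
    using slope_integral_le[OF assms(1) h1] unfolding \<Phi>_def J_def by (rule le_less_trans[rotated])
qed

section \<open>Mass of strips and characteristic functions\<close>

text \<open>Smoothing by a Gaussian: the indicator of the interval is at most twice the function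
\<open>exp (- (((z - z0) / r)\<^sup>2) / 2)\<close>, which is itself the characteristic function of a standard normal
variable. Fubini turns its expectation into a Gaussian average of \<open>char M (u / r)\<close>, and the
normal density is at most \<open>1 / 2\<close>.\<close>

lemma (in real_distribution) emeasure_interval_le_integral_char:
  assumes "0 < r"
  shows "emeasure M {z. \<bar>z - z0\<bar> \<le> r} \<le> ennreal r * (\<integral>\<^sup>+t. ennreal (cmod (char M t)) \<partial>lborel)"
proof -
  let ?G = "std_normal_distribution"
  interpret G: real_distribution ?G by (rule real_dist_normal_dist)
  interpret MG: pair_prob_space M ?G ..
  define w where "w z = exp (- (((z - z0) / r)\<^sup>2) / 2)" for z :: real
  have [measurable]: "w \<in> borel_measurable borel"
    unfolding w_def by measurable
  have w0: "0 \<le> w z" for z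
    by (simp add: w_def)
  have w_int: "integrable M w"
    by (rule integrable_const_bound[of _ 1]) (auto simp: w_def)
  have E0: "0 \<le> (\<integral>z. w z \<partial>M)"
    by (intro Bochner_Integration.integral_nonneg) (rule w0)
  have pair_int: "integrable (M \<Otimes>\<^sub>M ?G) (\<lambda>(z, u). iexp ((z - z0) / r * u))"
    by (rule MG.integrable_const_bound[of _ 1]) (auto simp: split_beta simp del: of_real_mult of_real_divide of_real_diff)
  have shift: "(CLINT z|M. iexp ((z - z0) / r * u)) = iexp (- z0 * u / r) * char M (u / r)" for u
  proof -
    have "iexp ((z - z0) / r * u) = iexp (- z0 * u / r) * iexp (u / r * z)" for z
      by (simp add: exp_add[symmetric] algebra_simps diff_divide_distrib)
    then show ?thesis by (simp add: char_def)
  qed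
  have "complex_of_real (\<integral>z. w z \<partial>M) = (CLINT z|M. complex_of_real (w z))"
    by (rule integral_complex_of_real[symmetric])
  also have "\<dots> = (CLINT z|M. char ?G ((z - z0) / r))"
    by (simp only: char_std_normal_distribution w_def)
  also have "\<dots> = (CLINT z|M. CLINT u|?G. iexp ((z - z0) / r * u))"
    by (simp add: char_def)
  also have "\<dots> = (CLINT u|?G. CLINT z|M. iexp ((z - z0) / r * u))"
    using MG.Fubini_integral[OF pair_int] by simp
  also have "\<dots> = (CLINT u|?G. iexp (- z0 * u / r) * char M (u / r))"
    by (simp only: shift)
  finally have E_eq: "complex_of_real (\<integral>z. w z \<partial>M) = (CLINT u|?G. iexp (- z0 * u / r) * char M (u / r))" .
  have "ennreal (\<integral>z. w z \<partial>M) = ennreal (cmod (CLINT u|?G. iexp (- z0 * u / r) * char M (u / r)))"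
    unfolding E_eq[symmetric] using E0 by simp
  also have "\<dots> \<le> (\<integral>\<^sup>+u. ennreal (cmod (iexp (- z0 * u / r) * char M (u / r))) \<partial>?G)"
  proof (rule integral_norm_bound_ennreal)
    show "integrable ?G (\<lambda>u. iexp (- z0 * u / r) * char M (u / r))"
      by (rule G.integrable_const_bound[of _ 1])
        (auto simp: norm_mult cmod_char_le_1 simp del: of_real_mult of_real_divide of_real_minus)
  qed
  also have "\<dots> = (\<integral>\<^sup>+u. ennreal (std_normal_density u) * ennreal (cmod (char M (u / r))) \<partial>lborel)"
    by (subst nn_integral_density) (auto simp: norm_mult simp del: of_real_mult of_real_divide of_real_minus)
  also have "\<dots> \<le> (\<integral>\<^sup>+u. ennreal (1 / 2) * ennreal (cmod (char M (u / r))) \<partial>lborel)"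
  proof (intro nn_integral_mono mult_right_mono ennreal_leI)
    fix u :: real
    have "2 \<le> sqrt (2 * pi)"
      using pi_ge_two by (intro real_le_rsqrt) simp
    then have "1 / sqrt (2 * pi) * exp (- u\<^sup>2 / 2) \<le> 1 / 2 * 1"
      by (intro mult_mono) (auto simp: field_simps)
    then show "std_normal_density u \<le> 1 / 2"
      by (simp add: std_normal_density_def)
  qed simp
  also have "\<dots> = ennreal (1 / 2) * (ennreal r * (\<integral>\<^sup>+t. ennreal (cmod (char M t)) \<partial>lborel))"
    using nn_integral_real_affine[of "\<lambda>u. ennreal (cmod (char M (u / r)))" r 0] assms
    by (simp add: nn_integral_cmult)
  finally have E_le: "ennreal (\<integral>z. w z \<partial>M) \<le> ennreal (1 / 2) * (ennreal r * (\<integral>\<^sup>+t. ennreal (cmod (char M t)) \<partial>lborel))" .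
  have "emeasure M {z. \<bar>z - z0\<bar> \<le> r} = (\<integral>\<^sup>+z. indicator {z. \<bar>z - z0\<bar> \<le> r} z \<partial>M)"
    by simp
  also have "\<dots> \<le> (\<integral>\<^sup>+z. 2 * ennreal (w z) \<partial>M)"
  proof (intro nn_integral_mono)
    fix z
    have "1 \<le> 2 * w z" if "\<bar>z - z0\<bar> \<le> r"
    proof -
      have "((z - z0) / r)\<^sup>2 \<le> 1"
        using that assms by (simp add: abs_square_le_1)
      then have "1 / 2 \<le> 1 + (- (((z - z0) / r)\<^sup>2) / 2)" by simp
      also have "\<dots> \<le> w z"
        unfolding w_def by (rule exp_ge_add_one_self)
      finally show ?thesis by simp
    qed
    moreover have "2 * ennreal (w z) = ennreal (2 * w z)"
      by (simp add: ennreal_mult' w_def)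
    ultimately show "indicator {z. \<bar>z - z0\<bar> \<le> r} z \<le> 2 * ennreal (w z)"
      using ennreal_leI[of 1 "2 * w z"] by (auto split: split_indicator)
  qed
  also have "\<dots> = 2 * ennreal (\<integral>z. w z \<partial>M)"
    using nn_integral_eq_integral[OF w_int] w0 by (simp add: nn_integral_cmult)
  also have "\<dots> \<le> 2 * (ennreal (1 / 2) * (ennreal r * (\<integral>\<^sup>+t. ennreal (cmod (char M t)) \<partial>lborel)))"
    by (intro mult_left_mono E_le) simp
  also have "\<dots> = (2 * ennreal (1 / 2)) * (ennreal r * (\<integral>\<^sup>+t. ennreal (cmod (char M t)) \<partial>lborel))"
    by (simp only: mult.assoc)
  also have "2 * ennreal (1 / 2) = 1"
    using ennreal_mult[of 2 "1/2"] by simp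
  finally show ?thesis by simp
qed

lemma cmod_char_minus: "cmod (char M (- t)) = cmod (char M t)"
proof -
  have "char M (- t) = (CLINT x|M. cnj (iexp (t * x)))"
    by (simp add: char_def exp_cnj)
  also have "\<dots> = cnj (char M t)"
    unfolding char_def by simp
  finally show ?thesis by simp
qed

text \<open>The signed distance to a line is a linear form in two independent coordinates, so its
characteristic function is a product of two values of \<open>char M\<close> along a line through the origin of
the frequency plane. The bound does not depend on the position \<open>x\<close> of the strip.\<close>

lemma emeasure_strip_le:
  assumes "real_distribution M" and "0 < r"
  shows "emeasure (M \<Otimes>\<^sub>M M) {y. \<bar>a * (snd y - snd x) - b * (fst y - fst x)\<bar> \<le> r} \<le>
    ennreal r * (\<integral>\<^sup>+t. ennreal (cmod (char M (t * a))) * ennreal (cmod (char M (t * b))) \<partial>lborel)"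
proof -
  interpret real_distribution M by fact
  interpret MM: pair_prob_space M M ..
  define Z where "Z y = a * snd y - b * fst y" for y :: "real \<times> real"
  have [measurable]: "Z \<in> borel_measurable (M \<Otimes>\<^sub>M M)"
    unfolding Z_def by measurable
  define D where "D = distr (M \<Otimes>\<^sub>M M) borel Z"
  interpret D: real_distribution D
    unfolding D_def real_distribution_def real_distribution_axioms_def
    by (auto intro: MM.prob_space_distr)
  have char_D: "char D t = char M (- (t * b)) * char M (t * a)" for t
  proof -
    have "char D t = (CLINT y|M \<Otimes>\<^sub>M M. iexp (t * Z y))"
      unfolding char_def D_def by (subst integral_distr) auto
    also have "\<dots> = (CLINT u|M. CLINT v|M. iexp (t * Z (u, v)))"
      by (rule MM.integral_fst'[symmetric], rule MM.integrable_const_bound[of _ 1])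
        (auto simp del: of_real_mult)
    also have "\<dots> = (CLINT u|M. CLINT v|M. iexp (- (t * b) * u) * iexp (t * a * v))"
      by (simp add: Z_def exp_add[symmetric] algebra_simps)
    also have "\<dots> = (CLINT u|M. iexp (- (t * b) * u) * (CLINT v|M. iexp (t * a * v)))"
      by simp
    also have "\<dots> = (CLINT u|M. iexp (- (t * b) * u)) * (CLINT v|M. iexp (t * a * v))"
      by simp
    finally show ?thesis
      by (simp add: char_def)
  qed
  have "emeasure (M \<Otimes>\<^sub>M M) {y. \<bar>a * (snd y - snd x) - b * (fst y - fst x)\<bar> \<le> r} =
      emeasure D {z. \<bar>z - Z x\<bar> \<le> r}"
    unfolding D_def
    by (subst emeasure_distr) (auto simp: Z_def space_pair_measure algebra_simps intro!: arg_cong[where f="emeasure _"])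
  also have "\<dots> \<le> ennreal r * (\<integral>\<^sup>+t. ennreal (cmod (char D t)) \<partial>lborel)"
    using \<open>0 < r\<close> by (rule D.emeasure_interval_le_integral_char)
  also have "\<dots> = ennreal r * (\<integral>\<^sup>+t. ennreal (cmod (char M (t * a))) * ennreal (cmod (char M (t * b))) \<partial>lborel)"
    by (simp add: char_D norm_mult ennreal_mult cmod_char_minus mult.commute)
  finally show ?thesis .
qed

section \<open>The characteristic function of a missing digits measure\<close>

text \<open>One factor is removed at a time. The interval of length \<open>2 * pi * p ^ Suc k\<close> consists of \<open>p\<close> translates
of the one of length \<open>2 * pi * p ^ k\<close>; the first \<open>k\<close> factors are invariant under these translations,
and the last factor is evaluated on a grid of mesh \<open>2 * pi / p\<close>, over which it sums to at most \<open>A\<close>.\<close>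

lemma nn_integral_riesz_product_le:
  fixes F :: "real \<Rightarrow> real" and A :: real and p :: nat
  assumes [measurable]: "F \<in> borel_measurable borel" and F0: "\<And>v. 0 \<le> F v"
    and per: "\<And>v m. F (v + 2 * pi * real m) = F v"
    and "0 < p" and "0 \<le> A"
    and sum_le: "\<And>u. 0 \<le> u \<Longrightarrow> u \<le> 2 * pi / p \<Longrightarrow> (\<Sum>j<p. F (u + 2 * pi * j / p)) \<le> A"
  shows "(\<integral>\<^sup>+t. ennreal (\<Prod>i<k. F (t / real p ^ Suc i)) * indicator {0..2 * pi * real p ^ k} t \<partial>lborel) \<le>
    ennreal (2 * pi * A ^ k)"
proof (induction k)
  case 0
  then show ?case by simp
next
  case (Suc k)
  define P where "P t = (\<Prod>i<k. F (t / real p ^ Suc i))" for t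
  define L where "L = 2 * pi * real p ^ k"
  have P0: "0 \<le> P t" for t
    unfolding P_def by (intro prod_nonneg) (simp add: F0)
  have [measurable]: "P \<in> borel_measurable borel"
    unfolding P_def by measurable
  have L0: "0 < L"
    using \<open>0 < p\<close> by (simp add: L_def)
  have P_per: "P (L * real j + x) = P x" for j x
  proof -
    have "F ((L * real j + x) / real p ^ Suc i) = F (x / real p ^ Suc i)" if "i < k" for i
    proof -
      have "real p ^ k = real p ^ Suc i * real p ^ (k - Suc i)"
        by (subst power_add[symmetric]) (use that in simp)
      then have "(L * real j + x) / real p ^ Suc i = x / real p ^ Suc i + 2 * pi * real (p ^ (k - Suc i) * j)"
        using \<open>0 < p\<close> by (simp add: L_def add_divide_distrib)
      then show ?thesis by (simp only: per)
    qed
    then show ?thesis by (simp add: P_def)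
  qed
  have split: "indicator {0..2 * pi * real p ^ Suc k} t \<le> (\<Sum>j<p. indicator {L * j..L * j + L} t :: ennreal)" for t
  proof (cases "t \<in> {0..2 * pi * real p ^ Suc k}")
    case True
    \<comment> \<open>The minimum accounts for the right endpoint, which the rounding would assign to the translate of index \<open>p\<close>.\<close>
    define j where "j = min (p - 1) (nat \<lfloor>t / L\<rfloor>)"
    have t: "0 \<le> t" "t \<le> real p * L"
      using True by (auto simp: L_def mult_ac)
    have f: "real (nat \<lfloor>t / L\<rfloor>) \<le> t / L" "t / L < real (nat \<lfloor>t / L\<rfloor>) + 1"
      using t L0 by (auto simp: of_nat_nat)
    have "real j \<le> t / L"
      using f(1) by (simp add: j_def)
    moreover have "t / L \<le> real j + 1"
    proof (cases "nat \<lfloor>t / L\<rfloor> \<le> p - 1")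
      case True
      then show ?thesis using f by (simp add: j_def)
    next
      case False
      then have "real j + 1 = real p" using \<open>0 < p\<close> by (simp add: j_def)
      then show ?thesis using t L0 by (simp add: field_simps)
    qed
    ultimately have "t \<in> {L * j..L * j + L}"
      using L0 by (simp add: field_simps)
    moreover have "j < p" using \<open>0 < p\<close> by (simp add: j_def)
    ultimately have "1 \<le> (\<Sum>j\<in>{j}. indicator {L * real j..L * j + L} t :: ennreal)"
      by simp
    also have "\<dots> \<le> (\<Sum>j<p. indicator {L * real j..L * j + L} t :: ennreal)"
      using \<open>j < p\<close> by (intro sum_mono2) auto
    finally show ?thesis using True by simp
  qed simp
  have "(\<integral>\<^sup>+t. ennreal (\<Prod>i<Suc k. F (t / real p ^ Suc i)) * indicator {0..2 * pi * real p ^ Suc k} t \<partial>lborel) \<le>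
      (\<integral>\<^sup>+t. (\<Sum>j<p. ennreal (P t * F (t / real p ^ Suc k)) * indicator {L * j..L * j + L} t) \<partial>lborel)"
    unfolding sum_distrib_left[symmetric] by (intro nn_integral_mono mult_mono split) (auto simp: P_def)
  also have "\<dots> = (\<Sum>j<p. \<integral>\<^sup>+t. ennreal (P t * F (t / real p ^ Suc k)) * indicator {L * j..L * j + L} t \<partial>lborel)"
    by (rule nn_integral_sum) measurable
  also have "\<dots> = (\<Sum>j<p. \<integral>\<^sup>+x. ennreal (P x * F (x / real p ^ Suc k + 2 * pi * j / p)) * indicator {0..L} x \<partial>lborel)"
  proof (rule sum.cong[OF refl])
    fix j
    have shift: "(L * real j + x) / real p ^ Suc k = x / real p ^ Suc k + 2 * pi * j / p" for x
      using \<open>0 < p\<close> by (simp add: L_def field_simps)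
    have "(\<integral>\<^sup>+t. ennreal (P t * F (t / real p ^ Suc k)) * indicator {L * j..L * j + L} t \<partial>lborel) =
        (\<integral>\<^sup>+x. ennreal (P (L * j + x) * F ((L * j + x) / real p ^ Suc k)) * indicator {L * j..L * j + L} (L * j + x) \<partial>lborel)"
      by (subst nn_integral_real_affine[of _ 1 "L * real j"]) auto
    also have "\<dots> = (\<integral>\<^sup>+x. ennreal (P x * F (x / real p ^ Suc k + 2 * pi * j / p)) * indicator {0..L} x \<partial>lborel)"
      unfolding P_per shift by (intro nn_integral_cong) (simp add: indicator_def)
    finally show "(\<integral>\<^sup>+t. ennreal (P t * F (t / real p ^ Suc k)) * indicator {L * j..L * j + L} t \<partial>lborel) =
        (\<integral>\<^sup>+x. ennreal (P x * F (x / real p ^ Suc k + 2 * pi * j / p)) * indicator {0..L} x \<partial>lborel)" .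
  qed
  also have "\<dots> = (\<integral>\<^sup>+x. (\<Sum>j<p. ennreal (P x * F (x / real p ^ Suc k + 2 * pi * j / p)) * indicator {0..L} x) \<partial>lborel)"
    by (rule nn_integral_sum[symmetric]) measurable
  also have "\<dots> \<le> (\<integral>\<^sup>+x. ennreal A * (ennreal (P x) * indicator {0..L} x) \<partial>lborel)"
  proof (intro nn_integral_mono)
    fix x
    show "(\<Sum>j<p. ennreal (P x * F (x / real p ^ Suc k + 2 * pi * j / p)) * indicator {0..L} x) \<le>
        ennreal A * (ennreal (P x) * indicator {0..L} x)"
    proof (cases "x \<in> {0..L}")
      case True
      have "(\<Sum>j<p. ennreal (P x * F (x / real p ^ Suc k + 2 * pi * j / p))) =
          ennreal (P x * (\<Sum>j<p. F (x / real p ^ Suc k + 2 * pi * j / p)))"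
        by (simp add: sum_ennreal P0 F0 sum_distrib_left)
      also have "\<dots> \<le> ennreal (P x * A)"
      proof (intro ennreal_leI mult_left_mono sum_le P0)
        show "0 \<le> x / real p ^ Suc k" using True by simp
        have "x / real p ^ Suc k \<le> L / real p ^ Suc k"
          using True by (intro divide_right_mono) auto
        also have "\<dots> = 2 * pi / p" using \<open>0 < p\<close> by (simp add: L_def)
        finally show "x / real p ^ Suc k \<le> 2 * pi / p" .
      qed
      finally show ?thesis
        using True P0 \<open>0 \<le> A\<close> by (simp add: ennreal_mult mult.commute)
    qed simp
  qed
  also have "\<dots> = ennreal A * (\<integral>\<^sup>+x. ennreal (P x) * indicator {0..L} x \<partial>lborel)"
    by (rule nn_integral_cmult) measurable
  also have "\<dots> \<le> ennreal A * ennreal (2 * pi * A ^ k)"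
    using Suc.IH unfolding P_def L_def by (intro mult_left_mono) auto
  also have "\<dots> = ennreal (2 * pi * A ^ Suc k)"
    using \<open>0 \<le> A\<close> by (simp add: ennreal_mult[symmetric] mult_ac)
  finally show ?case .
qed

text \<open>The characteristic function of a single uniformly distributed digit: for an interval of digits, a
normalised Dirichlet kernel.\<close>

definition digit_char :: "nat set \<Rightarrow> real \<Rightarrow> complex" where
  "digit_char D t = (\<Sum>d\<in>D. iexp (t * real d)) / of_nat (card D)"

lemma digit_char_measurable [measurable]: "digit_char D \<in> borel_measurable borel"
  unfolding digit_char_def by measurable

lemma digit_char_periodic: "digit_char D (t + 2 * pi * real m) = digit_char D t"
proof -
  have "iexp ((t + 2 * pi * real m) * real d) = iexp (t * real d)" for d
    using exp_plus_2pin[of "\<i> * complex_of_real (t * real d)" "int (m * d)"]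
    by (simp add: algebra_simps)
  then show ?thesis by (simp only: digit_char_def)
qed

lemma cmod_digit_char_le_1:
  assumes "finite D" "D \<noteq> {}"
  shows "cmod (digit_char D t) \<le> 1"
proof -
  have "cmod (\<Sum>d\<in>D. iexp (t * real d)) \<le> (\<Sum>d\<in>D. cmod (iexp (t * real d)))"
    by (rule norm_sum)
  also have "\<dots> = card D" by (simp del: of_real_mult)
  finally show ?thesis
    using assms by (simp add: digit_char_def norm_divide card_gt_0_iff)
qed

text \<open>Multiplying the geometric sum by \<open>iexp t - 1\<close>, whose modulus is \<open>2 * \<bar>sin (t / 2)\<bar>\<close>, leaves a
difference of two numbers of modulus one.\<close>

lemma cmod_digit_char_interval_le:
  assumes "0 < N"
  shows "cmod (digit_char {1..N} t) * \<bar>sin (t / 2)\<bar> \<le> 1 / N"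
proof -
  have "iexp (t * real d) = iexp t ^ d" for d
    by (simp add: exp_of_nat_mult[symmetric] mult_ac)
  then have "(\<Sum>d\<in>{1..N}. iexp (t * real d)) * (iexp t - 1) = (\<Sum>d\<in>{1..N}. iexp t ^ d * (iexp t - 1))"
    by (simp only: sum_distrib_right)
  also have "\<dots> = (\<Sum>d\<in>{1..N}. iexp t ^ Suc d - iexp t ^ d)"
    by (simp add: algebra_simps)
  also have "\<dots> = iexp t ^ Suc N - iexp t ^ 1"
    using \<open>0 < N\<close> by (intro sum_Suc_diff) simp
  finally have "cmod ((\<Sum>d\<in>{1..N}. iexp (t * real d)) * (iexp t - 1)) \<le> cmod (iexp t ^ Suc N) + cmod (iexp t ^ 1)"
    by (simp only: norm_triangle_ineq4)
  then have "cmod (\<Sum>d\<in>{1..N}. iexp (t * real d)) * (2 * \<bar>sin (t / 2)\<bar>) \<le> 2"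
    by (simp only: norm_mult norm_power dist_exp_i_1 norm_exp_i_times) simp
  then show ?thesis
    using \<open>0 < N\<close> by (simp add: digit_char_def norm_divide field_simps)
qed

lemma half_le_sin_pi:
  fixes x :: real
  assumes "0 \<le> x" "x \<le> 1 / 2"
  shows "x / 2 \<le> sin (pi * x)"
proof -
  define y where "y = pi * x"
  have "y \<le> 2"
    unfolding y_def using assms mult_mono[of pi 4 x "1 / 2"] pi_less_4 by simp
  have "0 \<le> y" unfolding y_def using assms by simp
  have "\<bar>sin y - y\<bar> \<le> y ^ 3 / 6"
    using Maclaurin_sin_bound[of y 3] \<open>0 \<le> y\<close> by (simp add: eval_nat_numeral sin_coeff_def field_simps)
  then have "y - sin y \<le> y ^ 3 / 6"
    by (simp only: abs_le_iff minus_diff_eq)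
  moreover have "y ^ 3 \<le> 4 * y"
    using \<open>0 \<le> y\<close> \<open>y \<le> 2\<close> mult_mono[of y 2 y 2] by (simp add: power3_eq_cube mult_right_mono)
  ultimately have "y / 3 \<le> sin y" by linarith
  moreover have "2 * x \<le> y"
    unfolding y_def using pi_ge_two assms by (intro mult_right_mono) auto
  ultimately show ?thesis using assms unfolding y_def by simp
qed

lemma inverse_sin_pi_le:
  fixes x :: real
  assumes "0 < x" "x < 1"
  shows "1 / sin (pi * x) \<le> 2 / x + 2 / (1 - x)"
proof -
  have *: "1 / sin (pi * y) \<le> 2 / y + 2 / (1 - y)" if "0 < y" "y \<le> 1 / 2" for y :: real
  proof -
    have "1 / sin (pi * y) \<le> 1 / (y / 2)"
      using half_le_sin_pi[of y] that by (intro divide_left_mono mult_pos_pos) auto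
    then show ?thesis using that by (simp add: add_increasing2)
  qed
  show ?thesis
  proof (cases "x \<le> 1 / 2")
    case False
    have "sin (pi * (1 - x)) = sin (pi * x)"
      by (simp add: right_diff_distrib sin_diff)
    then show ?thesis using *[of "1 - x"] False assms by simp
  qed (use * assms in simp)
qed

text \<open>The \<open>L\<^sup>1\<close> bound for the Dirichlet kernel on a grid, for which it matters that the
digits form an interval. The geometric sum is at most \<open>1 / (N * \<bar>sin (t / 2)\<bar>)\<close>, so the grid sum
is a harmonic sum, which costs only a logarithm over the trivial lower bound \<open>p / N\<close>.\<close>

lemma sum_digit_char_interval_le:
  fixes p N :: nat
  assumes "0 < N" "0 < p" and u: "0 \<le> u" "u \<le> 2 * pi / p"
  shows "(\<Sum>j<p. cmod (digit_char {1..N} (u + 2 * pi * j / p))) \<le> 2 + 4 * (p / N) * (1 + ln p)"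
proof -
  \<comment> \<open>The position of the grid relative to the multiples of its mesh; the point with index \<open>j\<close> is \<open>2 * pi * (j + \<tau>) / p\<close>.\<close>
  define \<tau> where "\<tau> = u * p / (2 * pi)"
  have \<tau>: "0 \<le> \<tau>" "\<tau> \<le> 1"
    using u \<open>0 < p\<close> by (simp_all add: \<tau>_def field_simps)
  \<comment> \<open>The two grid points next to a multiple of \<open>2 * pi\<close> are bounded trivially by 1.\<close>
  define e where "e j = (if j = 0 then 1 else 0) + (if j = p - 1 then 1 else (0::real))" for j
  have term_le: "cmod (digit_char {1..N} (u + 2 * pi * j / p)) \<le>
      e j + 2 * (p / N) * (1 / j + 1 / real (p - 1 - j))" (is "?c \<le> _") if "j < p" for j
  proof (cases "j = 0 \<or> j = p - 1")
    case True
    then have "1 \<le> e j" by (auto simp: e_def)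
    moreover have "?c \<le> 1" using \<open>0 < N\<close> by (intro cmod_digit_char_le_1) auto
    moreover have "0 \<le> 2 * (p / N) * (1 / j + 1 / real (p - 1 - j))" by simp
    ultimately show ?thesis by linarith
  next
    case False
    define x where "x = (j + \<tau>) / p"
    have jp: "1 \<le> real j" "real j + 2 \<le> real p"
      using False \<open>j < p\<close> by auto
    have x: "0 < x" "x < 1" using jp \<tau> by (simp_all add: x_def)
    have s0: "0 < sin (pi * x)"
      using x by (intro sin_gt_zero) auto
    have arg: "(u + 2 * pi * j / p) / 2 = pi * x"
      using \<open>0 < p\<close> by (simp add: x_def \<tau>_def field_simps)
    have "?c * sin (pi * x) \<le> 1 / N"
      using cmod_digit_char_interval_le[OF \<open>0 < N\<close>, of "u + 2 * pi * j / p"] s0 unfolding arg by simp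
    then have "?c \<le> 1 / N / sin (pi * x)"
      by (subst pos_le_divide_eq[OF s0])
    then have "?c \<le> (1 / N) * (1 / sin (pi * x))"
      by simp
    also have "\<dots> \<le> (1 / N) * (2 / x + 2 / (1 - x))"
      by (intro mult_left_mono inverse_sin_pi_le x) simp
    also have "2 / x + 2 / (1 - x) \<le> 2 * p / j + 2 * p / real (p - 1 - j)"
    proof (intro add_mono)
      show "2 / x \<le> 2 * p / j"
        using jp \<tau> by (simp add: x_def frac_le)
      have "1 - x = (p - (j + \<tau>)) / p" using jp by (simp add: x_def field_simps)
      moreover have "real (p - 1 - j) = real p - 1 - real j" using jp by simp
      ultimately show "2 / (1 - x) \<le> 2 * p / real (p - 1 - j)"
        using jp \<tau> by (simp add: frac_le)
    qed
    then have "(1 / N) * (2 / x + 2 / (1 - x)) \<le> (1 / N) * (2 * p / j + 2 * p / real (p - 1 - j))"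
      by (intro mult_left_mono) auto
    also have "\<dots> = 2 * (p / N) * (1 / j + 1 / real (p - 1 - j))"
      by (simp add: field_simps)
    finally show ?thesis using False by (simp add: e_def)
  qed
  have harm: "(\<Sum>j<p. 1 / real j) \<le> 1 + ln p"
  proof -
    have "(\<Sum>j<p. 1 / real j) \<le> (\<Sum>j\<in>{0..p}. 1 / real j)"
      by (intro sum_mono2) auto
    also have "\<dots> = (\<Sum>j\<in>{1..p}. 1 / real j)"
      by (intro sum.mono_neutral_right) (auto simp: not_less_eq_eq)
    also have "\<dots> = harm p"
      by (simp add: harm_def inverse_eq_divide)
    also have "\<dots> \<le> 1 + ln p"
      using euler_mascheroni_sequence_decreasing[of 1 p] \<open>0 < p\<close> by (simp add: harm_expand)
    finally show ?thesis .
  qed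
  have "(\<Sum>j<p. cmod (digit_char {1..N} (u + 2 * pi * j / p))) \<le>
      (\<Sum>j<p. e j + 2 * (p / N) * (1 / j + 1 / real (p - 1 - j)))"
    by (intro sum_mono term_le) simp
  also have "\<dots> = (\<Sum>j<p. e j) + 2 * (p / N) * ((\<Sum>j<p. 1 / real j) + (\<Sum>j<p. 1 / real (p - 1 - j)))"
    by (simp only: sum.distrib sum_distrib_left[symmetric])
  also have "(\<Sum>j<p. 1 / real (p - 1 - j)) = (\<Sum>j<p. 1 / real j)"
    using sum.nat_diff_reindex[of "\<lambda>j. 1 / real j" p] by simp
  also have "(\<Sum>j<p. e j) = 2"
    using \<open>0 < p\<close> by (simp add: e_def sum.distrib)
  also have "2 + 2 * (p / N) * ((\<Sum>j<p. 1 / real j) + (\<Sum>j<p. 1 / real j)) \<le> 2 + 2 * (p / N) * ((1 + ln p) + (1 + ln p))"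
    by (intro add_left_mono mult_left_mono add_mono harm) simp
  also have "\<dots> = 2 + 4 * (p / N) * (1 + ln p)"
    by (simp only: mult_2[symmetric])
  finally show ?thesis .
qed

lemma digit_sequence_space_iff:
  "d \<in> space (\<Pi>\<^sub>M i\<in>(UNIV :: nat set). uniform_count_measure D) \<longleftrightarrow> (\<forall>i. d i \<in> D)"
  by (auto simp: space_PiM space_uniform_count_measure PiE_UNIV_domain)

lemma digit_series_bounds:
  fixes d :: "nat \<Rightarrow> nat"
  assumes "2 \<le> p" and "\<And>i. d i \<le> m"
  shows "summable (\<lambda>i. real (d i) / real p ^ Suc i)"
    and "0 \<le> (\<Sum>i. real (d i) / real p ^ Suc i)" and "(\<Sum>i. real (d i) / real p ^ Suc i) \<le> m"
proof -
  have g: "(\<lambda>i. real m * (1 / 2) ^ Suc i) sums real m"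
    using sums_mult[OF power_half_series, of "real m"] by simp
  have le: "real (d i) / real p ^ Suc i \<le> real m * (1 / 2) ^ Suc i" for i
  proof -
    have "real (d i) / real p ^ Suc i \<le> real m / 2 ^ Suc i"
      using assms by (intro frac_le power_mono) auto
    then show ?thesis by (simp only: power_divide power_one times_divide_eq_right mult_1_right)
  qed
  show s: "summable (\<lambda>i. real (d i) / real p ^ Suc i)"
    by (rule summable_comparison_test'[OF sums_summable[OF g]]) (use le in auto)
  show "0 \<le> (\<Sum>i. real (d i) / real p ^ Suc i)"
    by (rule suminf_nonneg[OF s]) simp
  show "(\<Sum>i. real (d i) / real p ^ Suc i) \<le> m"
    using suminf_le[OF le s sums_summable[OF g]] sums_unique[OF g] by simp
qed

lemma measurable_digit_series:
  "(\<lambda>d. \<Sum>i. real (d i) / real p ^ Suc i) \<in> borel_measurable (\<Pi>\<^sub>M i\<in>(UNIV :: nat set). uniform_count_measure D)"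
proof -
  have "(\<lambda>d. real (d i)) \<in> borel_measurable (\<Pi>\<^sub>M i\<in>(UNIV :: nat set). uniform_count_measure D)" for i
  proof -
    have "real \<in> borel_measurable (uniform_count_measure D)"
      by (auto simp: measurable_def space_uniform_count_measure sets_uniform_count_measure)
    then show ?thesis
      by (rule measurable_compose[rotated]) (rule measurable_component_singleton, simp)
  qed
  then show ?thesis
    by (intro borel_measurable_suminf borel_measurable_divide borel_measurable_const)
qed

lemma real_distribution_missing_digits_measure:
  assumes "finite D" "D \<noteq> {}"
  shows "real_distribution (missing_digits_measure p D)"
  using prob_space_missing_digits_measure[OF assms]
  by (simp add: real_distribution_def real_distribution_axioms_def)

lemma AE_missing_digits_measure_bounded:
  assumes "2 \<le> p" and "D \<subseteq> {..m}"
  shows "AE u in missing_digits_measure p D. \<bar>u\<bar> \<le> m"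
proof -
  have "AE d in (\<Pi>\<^sub>M i\<in>(UNIV :: nat set). uniform_count_measure D). \<bar>\<Sum>i. real (d i) / real p ^ Suc i\<bar> \<le> m"
  proof (rule AE_I2)
    fix d assume "d \<in> space (\<Pi>\<^sub>M i\<in>(UNIV :: nat set). uniform_count_measure D)"
    then have "\<And>i. d i \<le> m"
      using assms by (auto simp: digit_sequence_space_iff)
    then show "\<bar>\<Sum>i. real (d i) / real p ^ Suc i\<bar> \<le> m"
      using digit_series_bounds(2,3)[OF \<open>2 \<le> p\<close>, of d m] by (simp only: abs_of_nonneg)
  qed
  then show ?thesis
    unfolding missing_digits_measure_def
    using measurable_digit_series[of p D] by (subst AE_distr_iff) (auto simp del: power_Suc)
qed

text \<open>Self-similarity: removing the first digit of a random digit sequence leaves a sequence with the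
same distribution, independent of that digit.\<close>

lemma char_missing_digits_measure:
  assumes "2 \<le> p" and fin: "finite D" "D \<noteq> {}"
  shows "char (missing_digits_measure p D) t =
    digit_char D (t / p) * char (missing_digits_measure p D) (t / p)"
proof -
  define U where "U = uniform_count_measure D"
  interpret U: prob_space U
    unfolding U_def using fin by (rule prob_space_uniform_count_measure)
  interpret S: sequence_space U ..
  interpret US: pair_prob_space U S.S ..
  define X where "X d = (\<Sum>i. real (d i) / real p ^ Suc i)" for d :: "nat \<Rightarrow> nat"
  have [measurable]: "X \<in> borel_measurable S.S"
    unfolding X_def U_def by (rule measurable_digit_series)
  have [measurable]: "(\<lambda>(s, w). case_nat s w) \<in> U \<Otimes>\<^sub>M S.S \<rightarrow>\<^sub>M S.S"
    by measurable
  obtain m where m: "D \<subseteq> {..m}"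
    using finite_nat_iff_bounded_le fin(1) by blast
  have char_X: "char (missing_digits_measure p D) t = (CLINT d|S.S. iexp (t * X d))" for t
    unfolding char_def missing_digits_measure_def U_def[symmetric] X_def[symmetric]
    by (subst integral_distr) auto
  have X_shift: "X (case_nat s w) = real s / p + X w / p" if "s \<in> space U" "w \<in> space S.S" for s w
  proof -
    have "case_nat s w i \<le> m" for i
      using that m by (auto simp: U_def digit_sequence_space_iff space_uniform_count_measure split: nat.split)
    then have "summable (\<lambda>i. real (case_nat s w i) / real p ^ Suc i)"
      by (rule digit_series_bounds(1)[OF \<open>2 \<le> p\<close>])
    from suminf_split_head[OF this]
    have "X (case_nat s w) = real s / p + (\<Sum>i. real (w i) / real p ^ Suc i / p)"
      by (simp add: X_def mult.commute)
    also have "(\<Sum>i. real (w i) / real p ^ Suc i / p) = X w / p"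
      unfolding X_def
      using that m by (intro suminf_divide digit_series_bounds(1)[OF \<open>2 \<le> p\<close>, where m=m])
        (auto simp: U_def digit_sequence_space_iff)
    finally show ?thesis .
  qed
  have "char (missing_digits_measure p D) t = (CLINT d|distr (U \<Otimes>\<^sub>M S.S) S.S (\<lambda>(s, w). case_nat s w). iexp (t * X d))"
    by (simp only: char_X S.PiM_iter)
  also have "\<dots> = (CLINT y|U \<Otimes>\<^sub>M S.S. iexp (t * X (case_nat (fst y) (snd y))))"
    by (subst integral_distr) (auto simp: split_beta)
  also have "\<dots> = (CLINT s|U. CLINT w|S.S. iexp (t * X (case_nat s w)))"
    by (subst US.integral_fst'[symmetric], rule US.integrable_const_bound[of _ 1])
      (auto simp del: of_real_mult)
  also have "\<dots> = (CLINT s|U. CLINT w|S.S. iexp (t / p * real s) * iexp (t / p * X w))"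
  proof (intro Bochner_Integration.integral_cong refl)
    fix s w assume "s \<in> space U" "w \<in> space S.S"
    then show "iexp (t * X (case_nat s w)) = iexp (t / p * real s) * iexp (t / p * X w)"
      by (simp add: X_shift exp_add[symmetric] algebra_simps)
  qed
  also have "\<dots> = (CLINT s|U. iexp (t / p * real s)) * char (missing_digits_measure p D) (t / p)"
    by (simp add: char_X)
  also have "(CLINT s|U. iexp (t / p * real s)) = digit_char D (t / p)"
    unfolding U_def uniform_count_measure_def digit_char_def
    using fin by (subst lebesgue_integral_point_measure_finite) (auto simp: sum_divide_distrib scaleR_conv_of_real)
  finally show ?thesis .
qed

lemma cmod_char_missing_digits_measure_le:
  assumes "2 \<le> p" and fin: "finite D" "D \<noteq> {}"
  shows "cmod (char (missing_digits_measure p D) t) \<le> (\<Prod>i<k. cmod (digit_char D (t / real p ^ Suc i)))"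
proof -
  interpret real_distribution "missing_digits_measure p D"
    using fin by (rule real_distribution_missing_digits_measure)
  have "char (missing_digits_measure p D) t =
      (\<Prod>i<k. digit_char D (t / real p ^ Suc i)) * char (missing_digits_measure p D) (t / real p ^ k)" for k
  proof (induction k)
    case (Suc k)
    have "char (missing_digits_measure p D) (t / real p ^ k) =
        digit_char D (t / real p ^ Suc k) * char (missing_digits_measure p D) (t / real p ^ Suc k)"
      using char_missing_digits_measure[OF assms, of "t / real p ^ k"] by (simp only: power_Suc2 divide_divide_eq_left)
    with Suc show ?case
      by (simp only: prod.lessThan_Suc mult.assoc)
  qed simp
  from this[of k] show ?thesis
    by (simp add: norm_mult prod_norm[symmetric] mult_left_le cmod_char_le_1 prod_nonneg)
qed

text \<open>Self-similarity bounds the characteristic function by a product of digit kernels at geometrically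
decreasing frequencies, whose integral grows by a factor of at most \<open>A\<close> per digit.\<close>

lemma nn_integral_char_missing_digits_le:
  fixes p N :: nat
  assumes "2 \<le> p" "0 < N"
  defines "A \<equiv> 2 + 4 * (real p / real N) * (1 + ln p)"
  shows "(\<integral>\<^sup>+t. ennreal (cmod (char (missing_digits_measure p {1..N}) t)) * indicator {t. \<bar>t\<bar> \<le> 2 * pi * real p ^ k} t \<partial>lborel)
    \<le> ennreal (4 * pi * A ^ k)"
proof -
  define L where "L = 2 * pi * real p ^ k"
  define \<psi> where "\<psi> t = ennreal (cmod (char (missing_digits_measure p {1..N}) t))" for t
  interpret real_distribution "missing_digits_measure p {1..N}"
    using \<open>0 < N\<close> by (intro real_distribution_missing_digits_measure) auto
  have [measurable]: "\<psi> \<in> borel_measurable borel"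
    unfolding \<psi>_def by measurable
  have A0: "0 \<le> A"
    using assms by (simp add: A_def)
  have half: "(\<integral>\<^sup>+t. \<psi> t * indicator {0..L} t \<partial>lborel) \<le> ennreal (2 * pi * A ^ k)"
  proof -
    have "(\<integral>\<^sup>+t. \<psi> t * indicator {0..L} t \<partial>lborel) \<le>
        (\<integral>\<^sup>+t. ennreal (\<Prod>i<k. cmod (digit_char {1..N} (t / real p ^ Suc i))) * indicator {0..2 * pi * real p ^ k} t \<partial>lborel)"
      unfolding \<psi>_def L_def using \<open>2 \<le> p\<close> \<open>0 < N\<close>
      by (intro nn_integral_mono mult_mono ennreal_leI cmod_char_missing_digits_measure_le) auto
    also have "\<dots> \<le> ennreal (2 * pi * A ^ k)"
    proof (rule nn_integral_riesz_product_le)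
      fix u :: real assume "0 \<le> u" "u \<le> 2 * pi / real p"
      then show "(\<Sum>j<p. cmod (digit_char {1..N} (u + 2 * pi * real j / real p))) \<le> A"
        unfolding A_def using assms by (intro sum_digit_char_interval_le) auto
    next
      show "cmod (digit_char {1..N} (v + 2 * pi * real m)) = cmod (digit_char {1..N} v)" for v m
        by (simp only: digit_char_periodic)
    qed (use \<open>2 \<le> p\<close> A0 in simp_all)
    finally show ?thesis .
  qed
  have "(\<integral>\<^sup>+t. \<psi> t * indicator {t. \<bar>t\<bar> \<le> L} t \<partial>lborel) \<le>
      (\<integral>\<^sup>+t. \<psi> t * indicator {0..L} t + \<psi> (- t) * indicator {0..L} (- t) \<partial>lborel)"
  proof (intro nn_integral_mono)
    fix t :: real
    have "\<psi> (- t) = \<psi> t"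
      unfolding \<psi>_def cmod_char_minus ..
    then show "\<psi> t * indicator {t. \<bar>t\<bar> \<le> L} t \<le> \<psi> t * indicator {0..L} t + \<psi> (- t) * indicator {0..L} (- t)"
      by (cases "0 \<le> t") (auto simp: indicator_def)
  qed
  also have "\<dots> = (\<integral>\<^sup>+t. \<psi> t * indicator {0..L} t \<partial>lborel) + (\<integral>\<^sup>+t. \<psi> (- t) * indicator {0..L} (- t) \<partial>lborel)"
    by (rule nn_integral_add) measurable
  also have "(\<integral>\<^sup>+t. \<psi> (- t) * indicator {0..L} (- t) \<partial>lborel) = (\<integral>\<^sup>+t. \<psi> t * indicator {0..L} t \<partial>lborel)"
    using nn_integral_real_affine[of "\<lambda>t. \<psi> t * indicator {0..L} t" "-1" 0] by simp
  also have "(\<integral>\<^sup>+t. \<psi> t * indicator {0..L} t \<partial>lborel) + (\<integral>\<^sup>+t. \<psi> t * indicator {0..L} t \<partial>lborel) \<le>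
      ennreal (2 * pi * A ^ k) + ennreal (2 * pi * A ^ k)"
    by (intro add_mono half)
  also have "\<dots> = ennreal (4 * pi * A ^ k)"
    using A0 by (simp flip: ennreal_plus)
  finally show ?thesis by (simp only: \<psi>_def L_def)
qed

section \<open>From strips to arcs of directions\<close>

abbreviation circle_point :: "real \<Rightarrow> real \<times> real" where
  "circle_point t \<equiv> (cos t, sin t)"

lemma circle_point_measurable [measurable]: "circle_point \<in> borel_measurable borel"
  by (intro borel_measurable_continuous_onI continuous_intros)

lemma sets_circle_measure [measurable_cong]: "sets circle_measure = sets (restrict_space borel (sphere 0 1))"
  by (simp add: circle_measure_def)

lemma nn_integral_circle_measure:
  assumes [measurable]: "f \<in> borel_measurable (restrict_space borel (sphere 0 1))"
  shows "(\<integral>\<^sup>+u. f u \<partial>circle_measure) = (\<integral>\<^sup>+t. f (circle_point t) * indicator {0..<2 * pi} t \<partial>lborel)"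
  unfolding circle_measure_def
  by (subst nn_integral_distr[OF measurable_circle_parametrisation])
    (auto simp: nn_integral_restrict_space)

lemma sets_radial_pushforward [simp]:
  "sets (radial_pushforward x M) = sets (restrict_space borel (sphere 0 1))"
  by (simp add: radial_pushforward_def)

lemma emeasure_radial_pushforward:
  fixes M :: "'a::euclidean_space measure"
  assumes "sets M = sets borel" and "B \<in> sets (restrict_space borel (sphere 0 1))"
  shows "emeasure (radial_pushforward x M) B = emeasure M {y. y \<noteq> x \<and> radial_projection x y \<in> B}"
proof -
  have sp: "space M = UNIV"
    using sets_eq_imp_space_eq[OF assms(1)] by simp
  have "- {x} \<inter> space M \<in> sets M"
    using assms(1) sp by simp
  then show ?thesis
    unfolding radial_pushforward_def
    by (subst emeasure_distr[OF measurable_radial_projection[OF assms(1)] assms(2)])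
      (auto simp: emeasure_restrict_space space_restrict_space sp intro!: arg_cong[where f="emeasure M"])
qed

lemma circle_arc_measurable:
  assumes "open C"
  shows "circle_point ` C \<in> sets (restrict_space borel (sphere 0 1))"
proof -
  obtain K :: "nat \<Rightarrow> real set" where K: "\<And>n. compact (K n)" "\<And>n. K n \<subseteq> C" "\<Union>(range K) = C"
    using open_Union_compact_subsets[OF assms] by metis
  have "closed (circle_point ` K n)" for n
    by (intro compact_imp_closed compact_continuous_image continuous_intros K)
  then have "(\<Union>n. circle_point ` K n) \<in> sets borel"
    by (intro sets.countable_UN) auto
  also have "(\<Union>n. circle_point ` K n) = circle_point ` C"
    using K(3) by blast
  finally have "circle_point ` C \<in> sets borel" .
  moreover have "circle_point ` C \<subseteq> sphere 0 1"
    by (auto simp: norm_Pair)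
  ultimately show ?thesis
    by (simp add: sets_restrict_space_iff)
qed

text \<open>If \<open>y\<close> is seen from \<open>x\<close> in a direction of the arc \<open>C\<close> and \<open>norm (y - x) \<le> R\<close>, then \<open>y\<close> lies in
the strip of half-width \<open>R * l\<close> around the line through \<open>x\<close> in the direction \<open>t\<close>, for every \<open>t \<in> C\<close>, where \<open>l\<close> is the
length of \<open>C\<close>. Averaging the strip bounds over \<open>t \<in> C\<close> cancels \<open>l\<close>, so the arc has mass at most
the integral of \<open>R * G\<close> over it.\<close>

lemma emeasure_arc_le:
  fixes Q :: "(real \<times> real) measure" and x :: "real \<times> real" and G :: "real \<times> real \<Rightarrow> ennreal"
  assumes Q: "sets Q = sets borel"
    and [measurable]: "G \<in> borel_measurable borel"
    and strip: "\<And>t r. 0 < r \<Longrightarrow>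
      emeasure Q {y. \<bar>cos t * (snd y - snd x) - sin t * (fst y - fst x)\<bar> \<le> r} \<le> ennreal r * G (circle_point t)"
    and "0 < R" and bdd: "AE y in Q. norm (y - x) \<le> R"
    and C: "open C" "connected C" "C \<noteq> {}" "emeasure lborel C < \<infinity>"
  shows "emeasure (radial_pushforward x Q) (circle_point ` C) \<le>
    (\<integral>\<^sup>+t. ennreal R * G (circle_point t) * indicator C t \<partial>lborel)"
proof -
  define l where "l = measure lborel C"
  have l: "emeasure lborel C = ennreal l"
    using C(4) by (simp add: l_def emeasure_eq_ennreal_measure)
  have [measurable]: "C \<in> sets borel" using C(1) by simp
  have le_l: "\<bar>s - t\<bar> \<le> l" if "s \<in> C" "t \<in> C" for s t
  proof -
    have "{min s t..max s t} \<subseteq> C"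
      using that C(2) by (intro connected_contains_Icc) (auto simp: min_def max_def)
    then have "emeasure lborel {min s t..max s t} \<le> emeasure lborel C"
      by (intro emeasure_mono) auto
    then have "ennreal \<bar>s - t\<bar> \<le> ennreal l"
      unfolding l by (auto simp: min_def max_def abs_if split: if_splits)
    then show ?thesis
      by (simp add: l_def ennreal_le_iff)
  qed
  have l0: "0 < l"
  proof -
    obtain t where "t \<in> C" using C(3) by blast
    then obtain e where e: "0 < e" "cball t e \<subseteq> C"
      using C(1) open_contains_cball by blast
    then have "t + e \<in> C" by (auto simp: dist_real_def)
    then have "\<bar>t + e - t\<bar> \<le> l" using \<open>t \<in> C\<close> by (rule le_l)
    then show ?thesis using e(1) by simp
  qed
  let ?\<nu> = "emeasure (radial_pushforward x Q) (circle_point ` C)"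
  have sp: "space Q = UNIV"
    using sets_eq_imp_space_eq[OF Q] by simp
  have *: "?\<nu> \<le> ennreal l * (ennreal R * G (circle_point t))" if "t \<in> C" for t
  proof -
    have "?\<nu> = emeasure Q {y. y \<noteq> x \<and> radial_projection x y \<in> circle_point ` C}"
      by (rule emeasure_radial_pushforward[OF Q circle_arc_measurable[OF C(1)]])
    also have "\<dots> \<le> emeasure Q {y. \<bar>cos t * (snd y - snd x) - sin t * (fst y - fst x)\<bar> \<le> R * l}"
    proof (rule emeasure_mono_AE)
      show "AE y in Q. y \<in> {y. y \<noteq> x \<and> radial_projection x y \<in> circle_point ` C} \<longrightarrow>
          y \<in> {y. \<bar>cos t * (snd y - snd x) - sin t * (fst y - fst x)\<bar> \<le> R * l}"
        using bdd
      proof (eventually_elim, safe)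
        fix y s assume y: "norm (y - x) \<le> R" "y \<noteq> x" "s \<in> C" and s: "radial_projection x y = circle_point s"
        define \<rho> where "\<rho> = norm (y - x)"
        have "0 < \<rho>" using \<open>y \<noteq> x\<close> by (simp add: \<rho>_def)
        then have "y - x = \<rho> *\<^sub>R circle_point s"
          unfolding s[symmetric] by (simp add: radial_projection_def \<rho>_def)
        then have "fst (y - x) = \<rho> * cos s" "snd (y - x) = \<rho> * sin s"
          by simp_all
        then have "cos t * (snd y - snd x) - sin t * (fst y - fst x) = \<rho> * sin (s - t)"
          by (simp add: sin_diff algebra_simps)
        also have "\<bar>\<dots>\<bar> \<le> R * l"
          unfolding abs_mult using y(1) \<open>0 < \<rho>\<close> \<open>0 < R\<close> le_l[OF \<open>s \<in> C\<close> \<open>t \<in> C\<close>] abs_sin_x_le_abs_x[of "s - t"]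
          by (intro mult_mono) (auto simp: \<rho>_def)
        finally show "\<bar>cos t * (snd y - snd x) - sin t * (fst y - fst x)\<bar> \<le> R * l" .
      qed
      have "closed {y :: real \<times> real. \<bar>cos t * (snd y - snd x) - sin t * (fst y - fst x)\<bar> \<le> R * l}"
        by (intro closed_Collect_le continuous_intros)
      then show "{y. \<bar>cos t * (snd y - snd x) - sin t * (fst y - fst x)\<bar> \<le> R * l} \<in> sets Q"
        unfolding Q by (rule borel_closed)
    qed
    also have "\<dots> \<le> ennreal (R * l) * G (circle_point t)"
      using \<open>0 < R\<close> l0 by (intro strip) simp
    finally show ?thesis
      using \<open>0 < R\<close> l0 by (simp add: ennreal_mult mult_ac)
  qed
  have "ennreal l * ?\<nu> = (\<integral>\<^sup>+t. ?\<nu> * indicator C t \<partial>lborel)"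
    by (subst nn_integral_cmult_indicator) (simp_all add: l mult.commute)
  also have "\<dots> \<le> (\<integral>\<^sup>+t. ennreal l * (ennreal R * G (circle_point t) * indicator C t) \<partial>lborel)"
    by (intro nn_integral_mono) (use * in \<open>auto split: split_indicator\<close>)
  also have "\<dots> = ennreal l * (\<integral>\<^sup>+t. ennreal R * G (circle_point t) * indicator C t \<partial>lborel)"
    by (rule nn_integral_cmult) measurable
  finally show ?thesis
    using l0 by (simp add: ennreal_mult_le_mult_iff)
qed

text \<open>An open set of angles is the disjoint union of its countably many components, each of which is an arc.\<close>

lemma radial_pushforward_open_le:
  fixes Q :: "(real \<times> real) measure" and x :: "real \<times> real" and G :: "real \<times> real \<Rightarrow> ennreal"
  assumes Q: "sets Q = sets borel"
    and [measurable]: "G \<in> borel_measurable borel"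
    and strip: "\<And>t r. 0 < r \<Longrightarrow>
      emeasure Q {y. \<bar>cos t * (snd y - snd x) - sin t * (fst y - fst x)\<bar> \<le> r} \<le> ennreal r * G (circle_point t)"
    and "0 < R" and bdd: "AE y in Q. norm (y - x) \<le> R"
    and U: "open U" "emeasure lborel U < \<infinity>"
  shows "emeasure (radial_pushforward x Q) (circle_point ` U) \<le>
    (\<integral>\<^sup>+t. ennreal R * G (circle_point t) * indicator U t \<partial>lborel)"
proof -
  have count: "countable (components U)"
    by (rule countable_disjoint_open_subsets)
      (use open_components[OF U(1)] pairwise_disjoint_components[of U] in \<open>auto simp: pairwise_def disjnt_def disjoint_def\<close>)
  \<comment> \<open>An enumeration of the components by natural numbers, padded with empty sets.\<close>
  define A where "A n = \<Union>{C \<in> components U. to_nat_on (components U) C = n}" for n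
  have A_cases: "A n = {} \<or> A n \<in> components U" for n
  proof (cases "\<exists>C\<in>components U. to_nat_on (components U) C = n")
    case True
    then obtain C where C: "C \<in> components U" "to_nat_on (components U) C = n" by blast
    then have "{C \<in> components U. to_nat_on (components U) C = n} = {C}"
      using inj_onD[OF inj_on_to_nat_on[OF count]] by blast
    then show ?thesis using C by (simp add: A_def)
  qed (auto simp: A_def)
  have disj: "disjoint_family A"
    unfolding disjoint_family_on_def
  proof safe
    fix m n t assume "m \<noteq> n" "t \<in> A m" "t \<in> A n"
    then obtain C D where "C \<in> components U" "D \<in> components U" "t \<in> C" "t \<in> D" "C \<noteq> D"
      by (auto simp: A_def)
    then show "t \<in> {}"
      using pairwise_disjoint_components[of U] by (auto simp: pairwise_def disjnt_def)
  qed
  have "(\<Union>n. A n) = \<Union>(components U)"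
    by (auto simp: A_def simp del: Union_components)
  then have UA: "U = (\<Union>n. A n)" by simp
  have open_A: "open (A n)" for n
    using A_cases[of n] open_components[OF U(1)] by auto
  have [measurable]: "A n \<in> sets borel" for n
    using open_A by simp
  have piece: "emeasure (radial_pushforward x Q) (circle_point ` A n) \<le>
      (\<integral>\<^sup>+t. ennreal R * G (circle_point t) * indicator (A n) t \<partial>lborel)" for n
  proof (cases "A n = {}")
    case False
    then have "A n \<in> components U" using A_cases by blast
    then have "connected (A n)" "A n \<subseteq> U"
      by (rule in_components_connected, rule in_components_subset)
    then have "emeasure lborel (A n) < \<infinity>"
      using emeasure_mono[of "A n" U lborel] U by (auto intro: le_less_trans)
    then show ?thesis
      by (intro emeasure_arc_le[OF Q _ strip \<open>0 < R\<close> bdd open_A \<open>connected (A n)\<close> False]) auto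
  qed simp
  have "emeasure (radial_pushforward x Q) (circle_point ` U) =
      emeasure (radial_pushforward x Q) (\<Union>n. circle_point ` A n)"
    by (simp add: UA image_UN)
  also have "\<dots> \<le> (\<Sum>n. emeasure (radial_pushforward x Q) (circle_point ` A n))"
    by (rule emeasure_subadditive_countably) (auto simp: open_A intro!: circle_arc_measurable)
  also have "\<dots> \<le> (\<Sum>n. \<integral>\<^sup>+t. ennreal R * G (circle_point t) * indicator (A n) t \<partial>lborel)"
    by (intro suminf_le piece) auto
  also have "\<dots> = (\<Sum>n. emeasure (density lborel (\<lambda>t. ennreal R * G (circle_point t))) (A n))"
    by (simp add: emeasure_density)
  also have "\<dots> = emeasure (density lborel (\<lambda>t. ennreal R * G (circle_point t))) (\<Union>n. A n)"
    by (intro suminf_emeasure disj) auto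
  also have "\<dots> = (\<integral>\<^sup>+t. ennreal R * G (circle_point t) * indicator U t \<partial>lborel)"
    using U(1) by (simp add: emeasure_density UA[symmetric])
  finally show ?thesis .
qed

text \<open>Outer regularity carries the bound from open sets of angles to Borel sets. Angles lie in
\<open>{0..<2 * pi}\<close>, which is not open, so a slightly larger interval \<open>{a<..<b}\<close> is used for the
approximation.\<close>

lemma radial_pushforward_le:
  fixes Q :: "(real \<times> real) measure" and x :: "real \<times> real" and G :: "real \<times> real \<Rightarrow> ennreal"
  assumes Q: "sets Q = sets borel"
    and G [measurable]: "G \<in> borel_measurable borel"
    and strip: "\<And>t r. 0 < r \<Longrightarrow>
      emeasure Q {y. \<bar>cos t * (snd y - snd x) - sin t * (fst y - fst x)\<bar> \<le> r} \<le> ennreal r * G (circle_point t)"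
    and "0 < R" and bdd: "AE y in Q. norm (y - x) \<le> R"
    and ab: "a < 0" "2 * pi \<le> b" and fin: "(\<integral>\<^sup>+t. G (circle_point t) * indicator {a<..<b} t \<partial>lborel) < \<infinity>"
    and B: "B \<in> sets (restrict_space borel (sphere 0 1))"
  shows "emeasure (radial_pushforward x Q) B \<le> (\<integral>\<^sup>+u. ennreal R * G u * indicator B u \<partial>circle_measure)"
proof -
  define D where "D = density lborel (\<lambda>t. ennreal R * G (circle_point t) * indicator {a<..<b} t)"
  have "emeasure D (space D) \<noteq> \<infinity>"
    using fin by (auto simp: D_def emeasure_density mult.assoc nn_integral_cmult ennreal_mult_eq_top_iff)
  have "B \<in> sets borel" "B \<subseteq> sphere 0 1"
    using B by (auto simp: sets_restrict_space_iff)
  define B' where "B' = {0..<2 * pi} \<inter> circle_point -` B"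
  have "circle_point -` B \<in> sets borel"
    by (rule measurable_sets_borel[OF _ \<open>B \<in> sets borel\<close>]) measurable
  then have [measurable]: "B' \<in> sets borel"
    unfolding B'_def by (intro sets.Int) auto
  have "emeasure (radial_pushforward x Q) B \<le> emeasure D V" if V: "B' \<subseteq> V" "open V" for V
  proof -
    define U where "U = V \<inter> {a<..<b}"
    have "open U" using V by (simp add: U_def open_Int)
    have "B \<subseteq> circle_point ` U"
    proof
      fix u assume "u \<in> B"
      then have "(fst u)\<^sup>2 + (snd u)\<^sup>2 = 1"
        using \<open>B \<subseteq> sphere 0 1\<close> by (cases u) (auto simp: norm_Pair)
      then obtain t where t: "0 \<le> t" "t < 2 * pi" "fst u = cos t" "snd u = sin t"
        by (rule sincos_total_2pi)
      then have u: "u = circle_point t" by (simp add: prod_eq_iff)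
      then have "t \<in> B'" using t \<open>u \<in> B\<close> by (simp add: B'_def)
      then show "u \<in> circle_point ` U"
        using V(1) t ab u by (auto simp: U_def)
    qed
    then have "emeasure (radial_pushforward x Q) B \<le> emeasure (radial_pushforward x Q) (circle_point ` U)"
      using \<open>open U\<close> by (intro emeasure_mono) (simp_all add: circle_arc_measurable)
    also have "\<dots> \<le> (\<integral>\<^sup>+t. ennreal R * G (circle_point t) * indicator U t \<partial>lborel)"
    proof (rule radial_pushforward_open_le[OF Q G strip \<open>0 < R\<close> bdd \<open>open U\<close>])
      have "emeasure lborel U \<le> emeasure lborel {a<..<b}"
        by (intro emeasure_mono) (auto simp: U_def)
      also have "\<dots> < \<infinity>"
        by (simp add: emeasure_lborel_Ioo ab order_trans[OF less_imp_le[OF ab(1)] order_trans[OF _ ab(2)]])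
      finally show "emeasure lborel U < \<infinity>" .
    qed
    also have "\<dots> = emeasure D V"
      using V(2) unfolding D_def
      by (subst emeasure_density) (auto simp: U_def indicator_inter_arith mult_ac intro!: nn_integral_cong)
    finally show ?thesis .
  qed
  then have "emeasure (radial_pushforward x Q) B \<le> (INF V\<in>{V. B' \<subseteq> V \<and> open V}. emeasure D V)"
    by (intro INF_greatest) auto
  also have "\<dots> = emeasure D B'"
    using \<open>emeasure D (space D) \<noteq> \<infinity>\<close> by (intro outer_regular[symmetric]) (auto simp: D_def)
  also have "\<dots> = (\<integral>\<^sup>+t. ennreal R * G (circle_point t) * indicator B (circle_point t) * indicator {0..<2 * pi} t \<partial>lborel)"
  proof -
    have "emeasure D B' = (\<integral>\<^sup>+t. ennreal R * G (circle_point t) * indicator {a<..<b} t * indicator B' t \<partial>lborel)"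
      unfolding D_def by (rule emeasure_density) measurable
    also have "\<dots> = (\<integral>\<^sup>+t. ennreal R * G (circle_point t) * indicator B (circle_point t) * indicator {0..<2 * pi} t \<partial>lborel)"
      using ab by (intro nn_integral_cong) (auto simp: B'_def split: split_indicator)
    finally show ?thesis .
  qed
  also have "\<dots> = (\<integral>\<^sup>+u. ennreal R * G u * indicator B u \<partial>circle_measure)"
  proof (rule nn_integral_circle_measure[symmetric])
    have "(\<lambda>u. ennreal R * G u * indicator B u) \<in> borel_measurable borel"
      using \<open>B \<in> sets borel\<close> by measurable
    then show "(\<lambda>u. ennreal R * G u * indicator B u) \<in> borel_measurable (restrict_space borel (sphere 0 1))"
      by (rule measurable_restrict_space1)
  qed
  finally show ?thesis .
qed

section \<open>Square integrability in terms of the angle\<close>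

text \<open>The integral of \<open>h \<otimes> h\<close> along the line through the origin in the direction \<open>u\<close>. For the modulus \<open>h\<close> of a
characteristic function this bounds the mass of strips in the direction \<open>u\<close>, relative to their
width.\<close>

definition line_integral :: "(real \<Rightarrow> ennreal) \<Rightarrow> real \<times> real \<Rightarrow> ennreal" where
  "line_integral h u = (\<integral>\<^sup>+t. h (t * fst u) * h (t * snd u) \<partial>lborel)"

lemma line_integral_measurable [measurable]:
  assumes [measurable]: "h \<in> borel_measurable borel"
  shows "line_integral h \<in> borel_measurable borel"
proof -
  have "line_integral h \<in> borel_measurable (borel \<Otimes>\<^sub>M borel)"
    unfolding line_integral_def[abs_def] by measurable
  then show ?thesis by (simp add: borel_prod)
qed

lemma line_integral_rotate:
  assumes "\<And>t. h (- t) = h t"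
  shows "line_integral h (circle_point (t + real j * (pi / 2))) = line_integral h (circle_point t)"
proof (induction j)
  case (Suc j)
  define s where "s = t + real j * (pi / 2)"
  have "t + real (Suc j) * (pi / 2) = s + pi / 2"
    by (simp add: s_def algebra_simps)
  then have "circle_point (t + real (Suc j) * (pi / 2)) = (- sin s, cos s)"
    by (simp only: sin_add cos_add) simp
  moreover have "line_integral h (- sin s, cos s) = line_integral h (circle_point s)"
    by (simp add: line_integral_def assms mult.commute)
  ultimately show ?case
    using Suc.IH by (simp only: s_def)
qed simp

text \<open>The substitution \<open>\<eta> = cos t * \<tau>\<close> replaces the angle by its slope; the Jacobian is
harmless because \<open>cos t \<ge> 1 / 2\<close> for these angles.\<close>

lemma line_integral_le_slope:
  assumes [measurable]: "h \<in> borel_measurable borel" and t: "- (pi / 4) \<le> t" "t \<le> pi / 4"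
  shows "line_integral h (circle_point t) \<le> 2 * (\<integral>\<^sup>+\<eta>. h \<eta> * h (tan t * \<eta>) \<partial>lborel)"
proof -
  \<comment> \<open>The comparison with \<open>pi / 3\<close> suffices and gives the rational bound \<open>1 / 2\<close>.\<close>
  have "cos (pi / 3) \<le> cos \<bar>t\<bar>"
    using t by (intro cos_monotone_0_pi_le) auto
  then have c: "1 / 2 \<le> cos t" by (simp add: cos_60)
  have "(\<integral>\<^sup>+\<eta>. h \<eta> * h (tan t * \<eta>) \<partial>lborel) =
      ennreal \<bar>cos t\<bar> * (\<integral>\<^sup>+\<eta>. h (0 + cos t * \<eta>) * h (tan t * (0 + cos t * \<eta>)) \<partial>lborel)"
    using c by (intro nn_integral_real_affine) auto
  also have "(\<integral>\<^sup>+\<eta>. h (0 + cos t * \<eta>) * h (tan t * (0 + cos t * \<eta>)) \<partial>lborel) = line_integral h (circle_point t)"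
    using c unfolding line_integral_def by (intro nn_integral_cong) (auto simp: tan_def mult_ac)
  finally have "2 * (\<integral>\<^sup>+\<eta>. h \<eta> * h (tan t * \<eta>) \<partial>lborel) =
      (ennreal 2 * ennreal (cos t)) * line_integral h (circle_point t)"
    using c by (simp add: mult.assoc)
  moreover have "1 \<le> ennreal 2 * ennreal (cos t)"
    using c ennreal_leI[of 1 "2 * cos t"] by (simp add: ennreal_mult')
  ultimately show ?thesis
    using mult_right_mono[of 1 "ennreal 2 * ennreal (cos t)" "line_integral h (circle_point t)"] by simp
qed

lemma nn_integral_tan_le:
  fixes f :: "real \<Rightarrow> ennreal"
  assumes [measurable]: "f \<in> borel_measurable borel"
  shows "(\<integral>\<^sup>+t. f (tan t) * indicator {- (pi / 4)..pi / 4} t \<partial>lborel) \<le> (\<integral>\<^sup>+s. f s * indicator {-1..1} s \<partial>lborel)"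
proof -
  have cos0: "cos t > 0" if "t \<in> {- (pi / 4)..pi / 4}" for t
  proof (rule cos_gt_zero_pi)
    show "- (pi / 2) < t" "t < pi / 2"
      using that pi_gt_zero unfolding atLeastAtMost_iff by linarith+
  qed
  have "(\<integral>\<^sup>+s. f s * indicator {tan (- (pi / 4))..tan (pi / 4)} s \<partial>lborel) =
      (\<integral>\<^sup>+t. f (tan t) * ennreal (inverse ((cos t)\<^sup>2)) * indicator {- (pi / 4)..pi / 4} t \<partial>lborel)"
  proof (rule nn_integral_substitution_aux)
    show "(tan has_real_derivative inverse ((cos t)\<^sup>2)) (at t)" if "t \<in> {- (pi / 4)..pi / 4}" for t
      using cos0[OF that] by (intro DERIV_tan) simp
    show "continuous_on {- (pi / 4)..pi / 4} (\<lambda>t. inverse ((cos t)\<^sup>2))"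
      by (intro continuous_intros) (use cos0 in force)
  qed auto
  moreover have "(\<integral>\<^sup>+t. f (tan t) * indicator {- (pi / 4)..pi / 4} t \<partial>lborel) \<le>
      (\<integral>\<^sup>+t. f (tan t) * ennreal (inverse ((cos t)\<^sup>2)) * indicator {- (pi / 4)..pi / 4} t \<partial>lborel)"
  proof (intro nn_integral_mono)
    fix t :: real
    have "1 \<le> ennreal (inverse ((cos t)\<^sup>2))" if "t \<in> {- (pi / 4)..pi / 4}"
    proof -
      have "1 \<le> inverse ((cos t)\<^sup>2)"
        using cos0[OF that] by (intro one_le_inverse) (auto simp: abs_square_le_1)
      then show ?thesis using ennreal_leI by fastforce
    qed
    then show "f (tan t) * indicator {- (pi / 4)..pi / 4} t \<le>
        f (tan t) * ennreal (inverse ((cos t)\<^sup>2)) * indicator {- (pi / 4)..pi / 4} t"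
      using mult_left_mono[of 1 "ennreal (inverse ((cos t)\<^sup>2))" "f (tan t)"] by (auto split: split_indicator)
  qed
  ultimately show ?thesis by (simp add: tan_45 tan_minus)
qed

text \<open>Line integrals of \<open>h \<otimes> h\<close> are invariant under quarter turns, since these exchange the two even factors; so it
suffices to treat angles with slope in \<open>{-1..1}\<close>, and five quarters cover the interval.\<close>

lemma line_integral_square_integrable:
  fixes h :: "real \<Rightarrow> ennreal"
  assumes [measurable]: "h \<in> borel_measurable borel" and even: "\<And>t. h (- t) = h t"
    and fin: "(\<integral>\<^sup>+s. (\<integral>\<^sup>+\<eta>. h \<eta> * h (s * \<eta>) \<partial>lborel)\<^sup>2 * indicator {-1..1} s \<partial>lborel) < \<infinity>"
  shows "(\<integral>\<^sup>+t. (line_integral h (circle_point t))\<^sup>2 * indicator {- (pi / 4)..9 * pi / 4} t \<partial>lborel) < \<infinity>"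
proof -
  have [measurable]: "(tan :: real \<Rightarrow> real) \<in> borel_measurable borel"
    unfolding tan_def[abs_def] by measurable
  define H where "H t = (line_integral h (circle_point t))\<^sup>2" for t
  have [measurable]: "H \<in> borel_measurable borel"
    unfolding H_def by measurable
  let ?I = "{- (pi / 4)..pi / 4}"
  have quarter: "(\<integral>\<^sup>+t. H t * indicator ?I t \<partial>lborel) < \<infinity>"
  proof -
    have "(\<integral>\<^sup>+t. H t * indicator ?I t \<partial>lborel) \<le>
        (\<integral>\<^sup>+t. 4 * ((\<integral>\<^sup>+\<eta>. h \<eta> * h (tan t * \<eta>) \<partial>lborel)\<^sup>2 * indicator ?I t) \<partial>lborel)"
    proof (intro nn_integral_mono)
      fix t
      show "H t * indicator ?I t \<le> 4 * ((\<integral>\<^sup>+\<eta>. h \<eta> * h (tan t * \<eta>) \<partial>lborel)\<^sup>2 * indicator ?I t)"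
        using power_mono[OF line_integral_le_slope[of h t], of 2]
        by (auto simp: H_def power_mult_distrib split: split_indicator)
    qed
    also have "\<dots> = 4 * (\<integral>\<^sup>+t. (\<integral>\<^sup>+\<eta>. h \<eta> * h (tan t * \<eta>) \<partial>lborel)\<^sup>2 * indicator ?I t \<partial>lborel)"
      by (intro nn_integral_cmult) measurable
    also have "\<dots> \<le> 4 * (\<integral>\<^sup>+s. (\<integral>\<^sup>+\<eta>. h \<eta> * h (s * \<eta>) \<partial>lborel)\<^sup>2 * indicator {-1..1} s \<partial>lborel)"
      by (intro mult_left_mono nn_integral_tan_le) auto
    also have "\<dots> < \<infinity>"
      using fin by (simp add: ennreal_mult_less_top)
    finally show ?thesis .
  qed
  have rotate: "line_integral h (circle_point (t + real j * (pi / 2))) = line_integral h (circle_point t)" for t j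
    by (rule line_integral_rotate) (rule even)
  have shift: "(\<integral>\<^sup>+t. H t * indicator ?I (t - real j * (pi / 2)) \<partial>lborel) = (\<integral>\<^sup>+t. H t * indicator ?I t \<partial>lborel)" for j
  proof -
    have "(\<integral>\<^sup>+t. H t * indicator ?I (t - real j * (pi / 2)) \<partial>lborel) =
        (\<integral>\<^sup>+t. H (real j * (pi / 2) + 1 * t) * indicator ?I (real j * (pi / 2) + 1 * t - real j * (pi / 2)) \<partial>lborel)"
      by (subst nn_integral_real_affine[where c=1 and t="real j * (pi / 2)"]) auto
    also have "\<dots> = (\<integral>\<^sup>+t. H t * indicator ?I t \<partial>lborel)"
      using rotate[of _ j] by (simp only: H_def mult_1 add_diff_cancel_right' add.commute[of "real j * (pi / 2)"])
    finally show ?thesis .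
  qed
  have cover: "indicator {- (pi / 4)..9 * pi / 4} t \<le> (\<Sum>j<5. indicator ?I (t - real j * (pi / 2)) :: ennreal)" for t
  proof (cases "t \<in> {- (pi / 4)..9 * pi / 4}")
    case True
    have "\<exists>j<5. t - real j * (pi / 2) \<in> ?I"
    proof -
      consider "t \<le> pi / 4" | "pi / 4 \<le> t" "t \<le> 3 * pi / 4" | "3 * pi / 4 \<le> t" "t \<le> 5 * pi / 4"
        | "5 * pi / 4 \<le> t" "t \<le> 7 * pi / 4" | "7 * pi / 4 \<le> t"
        by linarith
      then show ?thesis
      proof cases
        case 1 then show ?thesis using True by (intro exI[of _ 0]) auto
      next
        case 2 then show ?thesis by (intro exI[of _ 1]) auto
      next
        case 3 then show ?thesis by (intro exI[of _ 2]) auto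
      next
        case 4 then show ?thesis by (intro exI[of _ 3]) auto
      next
        case 5 then show ?thesis using True by (intro exI[of _ 4]) auto
      qed
    qed
    then obtain j :: nat where j: "j < 5" "t - real j * (pi / 2) \<in> ?I" by blast
    then have "1 \<le> (\<Sum>j\<in>{j}. indicator ?I (t - real j * (pi / 2)) :: ennreal)" by simp
    also have "\<dots> \<le> (\<Sum>j<5. indicator ?I (t - real j * (pi / 2)))"
      using j by (intro sum_mono2) auto
    finally show ?thesis using True by simp
  qed simp
  have "(\<integral>\<^sup>+t. H t * indicator {- (pi / 4)..9 * pi / 4} t \<partial>lborel) \<le>
      (\<integral>\<^sup>+t. (\<Sum>j<5. H t * indicator ?I (t - real j * (pi / 2))) \<partial>lborel)"
    unfolding sum_distrib_left[symmetric] by (intro nn_integral_mono mult_left_mono cover) auto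
  also have "\<dots> = (\<Sum>j<5. \<integral>\<^sup>+t. H t * indicator ?I (t - real j * (pi / 2)) \<partial>lborel)"
    by (rule nn_integral_sum) measurable
  also have "\<dots> < \<infinity>"
    unfolding shift using quarter by (simp add: ennreal_mult_less_top)
  finally show ?thesis by (simp add: H_def)
qed

section \<open>Square integrable densities of dominated measures\<close>

lemma ennreal_le_1_add_square: "x \<le> 1 + x\<^sup>2" for x :: ennreal
proof (cases "x \<le> 1")
  case True
  then show ?thesis by (rule order_trans) simp
next
  case False
  then have "x * 1 \<le> x * x" by (intro mult_left_mono) auto
  then show ?thesis by (simp add: power2_eq_square add_increasing)
qed

text \<open>The density that the Radon-Nikodym theorem provides is at most \<open>g\<close> almost everywhere, because the
set on which it exceeds \<open>g\<close> would otherwise violate the domination.\<close>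

lemma dominated_measure_has_square_integrable_density:
  fixes g :: "'a \<Rightarrow> ennreal"
  assumes "finite_measure M" and sets_N: "sets N = sets M"
    and [measurable]: "g \<in> borel_measurable M"
    and dom: "\<And>B. B \<in> sets M \<Longrightarrow> emeasure N B \<le> (\<integral>\<^sup>+u. g u * indicator B u \<partial>M)"
    and fin: "(\<integral>\<^sup>+u. (g u)\<^sup>2 \<partial>M) < \<infinity>"
  shows "absolutely_continuous M N \<and>
    (\<exists>f :: 'a \<Rightarrow> real. f \<in> borel_measurable M \<and> (\<forall>u. 0 \<le> f u) \<and>
      N = density M (\<lambda>u. ennreal (f u)) \<and> integrable M (\<lambda>u. (f u)\<^sup>2))"
proof -
  interpret finite_measure M by fact
  have g_fin: "(\<integral>\<^sup>+u. g u \<partial>M) < \<infinity>"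
  proof -
    have "(\<integral>\<^sup>+u. g u \<partial>M) \<le> (\<integral>\<^sup>+u. 1 + (g u)\<^sup>2 \<partial>M)"
      by (intro nn_integral_mono ennreal_le_1_add_square)
    also have "\<dots> = emeasure M (space M) + (\<integral>\<^sup>+u. (g u)\<^sup>2 \<partial>M)"
      by (subst nn_integral_add) auto
    also have "\<dots> < \<infinity>"
      using fin by (simp add: emeasure_eq_measure)
    finally show ?thesis .
  qed
  have ac: "absolutely_continuous M N"
    unfolding absolutely_continuous_def
  proof
    fix B assume B: "B \<in> null_sets M"
    then have "(\<integral>\<^sup>+u. g u * indicator B u \<partial>M) = 0"
      by (intro nn_integral_null_set)
    then show "B \<in> null_sets N"
      using dom[of B] B sets_N by (auto simp: null_sets_def)
  qed
  obtain k where [measurable]: "k \<in> borel_measurable M" and k: "density M k = N"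
    using Radon_Nikodym[OF ac sets_N] by blast
  have le: "AE u in M. k u \<le> g u"
  proof -
    define B where "B = {u \<in> space M. g u < k u}"
    have [measurable]: "B \<in> sets M" unfolding B_def by measurable
    have gB: "(\<integral>\<^sup>+u. g u * indicator B u \<partial>M) \<noteq> \<infinity>"
    proof -
      have "(\<integral>\<^sup>+u. g u * indicator B u \<partial>M) \<le> (\<integral>\<^sup>+u. g u \<partial>M)"
        by (intro nn_integral_mono) (auto split: split_indicator)
      then show ?thesis using g_fin by auto
    qed
    have "(\<integral>\<^sup>+u. k u * indicator B u - g u * indicator B u \<partial>M) =
        (\<integral>\<^sup>+u. k u * indicator B u \<partial>M) - (\<integral>\<^sup>+u. g u * indicator B u \<partial>M)"
      using gB by (intro nn_integral_diff) (auto simp: B_def split: split_indicator)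
    also have "\<dots> = 0"
    proof (rule diff_eq_0_ennreal)
      show "(\<integral>\<^sup>+u. k u * indicator B u \<partial>M) \<le> (\<integral>\<^sup>+u. g u * indicator B u \<partial>M)"
        using dom[of B] by (simp add: k[symmetric] emeasure_density)
      then show "(\<integral>\<^sup>+u. k u * indicator B u \<partial>M) < top"
        using gB by (simp add: le_less_trans less_top)
    qed
    finally have "AE u in M. k u * indicator B u - g u * indicator B u = 0"
      by (subst (asm) nn_integral_0_iff_AE) auto
    then show ?thesis
    proof (rule AE_mp, intro AE_I2 impI)
      fix u assume u: "u \<in> space M" "k u * indicator B u - g u * indicator B u = 0"
      show "k u \<le> g u"
      proof (rule ccontr)
        assume "\<not> k u \<le> g u"
        with u(1) have "u \<in> B" by (auto simp: B_def)
        then show False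
          using u(2) \<open>\<not> k u \<le> g u\<close> by (auto simp: ennreal_minus_eq_0)
      qed
    qed
  qed
  have g_top: "AE u in M. g u \<noteq> \<infinity>"
    using g_fin by (intro nn_integral_PInf_AE) auto
  define f where "f u = enn2real (k u)" for u
  have [measurable]: "f \<in> borel_measurable M" unfolding f_def by measurable
  have fk: "AE u in M. ennreal (f u) = k u"
    using le g_top by eventually_elim (auto simp: f_def less_top top_unique)
  have "N = density M (\<lambda>u. ennreal (f u))"
    unfolding k[symmetric] using fk by (intro density_cong) auto
  moreover have "integrable M (\<lambda>u. (f u)\<^sup>2)"
  proof (rule integrableI_bounded)
    have "(\<integral>\<^sup>+u. ennreal (norm ((f u)\<^sup>2)) \<partial>M) \<le> (\<integral>\<^sup>+u. (g u)\<^sup>2 \<partial>M)"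
    proof (rule nn_integral_mono_AE)
      show "AE u in M. ennreal (norm ((f u)\<^sup>2)) \<le> (g u)\<^sup>2"
        using fk le
      proof eventually_elim
        fix u assume "ennreal (f u) = k u" "k u \<le> g u"
        then have "(ennreal (f u))\<^sup>2 \<le> (g u)\<^sup>2" by (intro power_mono) auto
        then show "ennreal (norm ((f u)\<^sup>2)) \<le> (g u)\<^sup>2"
          by (simp add: ennreal_power f_def)
      qed
    qed
    then show "(\<integral>\<^sup>+u. ennreal (norm ((f u)\<^sup>2)) \<partial>M) < \<infinity>"
      using fin by (rule le_less_trans)
  qed measurable
  ultimately show ?thesis
    using ac by (intro conjI exI[of _ f]) (auto simp: f_def)
qed

section \<open>Radial projections of missing digits measures\<close>

text \<open>The base of the third power is the \<open>L\<^sup>1\<close> growth rate of the characteristic function. Since the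
strip bounds are uniform in the position of the strip, the point \<open>x\<close> enters the domination only
through the radius \<open>R\<close> of a disc around \<open>x\<close> that carries the measure.\<close>

theorem radial_pushforward_missing_digits_density:
  fixes p N :: nat and x :: "real \<times> real"
  assumes "2 \<le> p" "0 < N" and A3: "(2 + 4 * (real p / real N) * (1 + ln p)) ^ 3 < real p"
  defines "lam \<equiv> missing_digits_measure p {1..N}"
  shows "absolutely_continuous circle_measure (radial_pushforward x (lam \<Otimes>\<^sub>M lam)) \<and>
    (\<exists>f :: real \<times> real \<Rightarrow> real.
        f \<in> borel_measurable circle_measure \<and> (\<forall>u. 0 \<le> f u) \<and>
        radial_pushforward x (lam \<Otimes>\<^sub>M lam) = density circle_measure (\<lambda>u. ennreal (f u)) \<and>
        integrable circle_measure (\<lambda>u. (f u)\<^sup>2))"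
proof -
  interpret real_distribution lam
    unfolding lam_def using \<open>0 < N\<close> by (intro real_distribution_missing_digits_measure) auto
  interpret LL: pair_prob_space lam lam ..
  define \<psi> where "\<psi> t = ennreal (cmod (char lam t))" for t
  define G where "G = line_integral \<psi>"
  have [measurable]: "\<psi> \<in> borel_measurable borel"
    unfolding \<psi>_def by measurable
  have [measurable]: "G \<in> borel_measurable borel"
    unfolding G_def by measurable
  have G2: "(\<integral>\<^sup>+t. (G (circle_point t))\<^sup>2 * indicator {- (pi / 4)..9 * pi / 4} t \<partial>lborel) < \<infinity>"
    unfolding G_def
  proof (rule line_integral_square_integrable)
    show "(\<integral>\<^sup>+s. (\<integral>\<^sup>+\<eta>. \<psi> \<eta> * \<psi> (s * \<eta>) \<partial>lborel)\<^sup>2 * indicator {-1..1} s \<partial>lborel) < \<infinity>"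
    proof (rule slope_integral_finite[OF _ _ _ _ _ _ A3, where C="4 * pi" and c="2 * pi"])
      show "(\<integral>\<^sup>+t. \<psi> t * indicator {t. \<bar>t\<bar> \<le> 2 * pi * real p ^ k} t \<partial>lborel) \<le>
          ennreal (4 * pi * (2 + 4 * (real p / real N) * (1 + ln p)) ^ k)" for k
        unfolding \<psi>_def lam_def using assms(1,2) by (rule nn_integral_char_missing_digits_le)
    qed (use assms(1,2) cmod_char_le_1 in \<open>auto simp: \<psi>_def\<close>)
  qed (auto simp: \<psi>_def cmod_char_minus)
  have G1: "(\<integral>\<^sup>+t. G (circle_point t) * indicator {- (pi / 4)<..<9 * pi / 4} t \<partial>lborel) < \<infinity>"
  proof -
    let ?I = "{- (pi / 4)..9 * pi / 4}"
    have "(\<integral>\<^sup>+t. G (circle_point t) * indicator {- (pi / 4)<..<9 * pi / 4} t \<partial>lborel) \<le>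
        (\<integral>\<^sup>+t. indicator ?I t + (G (circle_point t))\<^sup>2 * indicator ?I t \<partial>lborel)"
      by (intro nn_integral_mono) (auto split: split_indicator intro: ennreal_le_1_add_square)
    also have "\<dots> = emeasure lborel ?I + (\<integral>\<^sup>+t. (G (circle_point t))\<^sup>2 * indicator ?I t \<partial>lborel)"
      by (subst nn_integral_add) auto
    also have "\<dots> < \<infinity>"
      using G2 by simp
    finally show ?thesis .
  qed
  \<comment> \<open>Both coordinates of a random point are at most \<open>N\<close> in absolute value.\<close>
  define R where "R = 2 * real N + norm x"
  have "0 < R" using \<open>0 < N\<close> by (simp add: R_def add_pos_nonneg)
  have "sets (lam \<Otimes>\<^sub>M lam) = sets (borel \<Otimes>\<^sub>M borel)"
    by (intro sets_pair_measure_cong events_eq_borel)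
  then have Q: "sets (lam \<Otimes>\<^sub>M lam) = sets borel"
    by (simp only: borel_prod)
  have bdd: "AE y in lam \<Otimes>\<^sub>M lam. norm (y - x) \<le> R"
  proof (rule LL.AE_pair_measure)
    have "closed {y :: real \<times> real. norm (y - x) \<le> R}"
      by (intro closed_Collect_le continuous_intros)
    moreover have "space (lam \<Otimes>\<^sub>M lam) = UNIV"
      by (simp add: space_pair_measure)
    ultimately show "{y \<in> space (lam \<Otimes>\<^sub>M lam). norm (y - x) \<le> R} \<in> sets (lam \<Otimes>\<^sub>M lam)"
      unfolding Q using borel_closed by simp
    have ae: "AE u in lam. \<bar>u\<bar> \<le> real N"
      unfolding lam_def using \<open>2 \<le> p\<close> by (intro AE_missing_digits_measure_bounded) auto
    show "AE u in lam. AE v in lam. norm ((u, v) - x) \<le> R"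
      using ae
    proof eventually_elim
      fix u assume u: "\<bar>u\<bar> \<le> real N"
      show "AE v in lam. norm ((u, v) - x) \<le> R"
        using ae
      proof eventually_elim
        fix v assume v: "\<bar>v\<bar> \<le> real N"
        have "norm ((u, v) - x) \<le> norm (u, v) + norm x" by (rule norm_triangle_ineq4)
        also have "\<dots> \<le> \<bar>u\<bar> + \<bar>v\<bar> + norm x" using norm_Pair_le[of u v] by simp
        finally show "norm ((u, v) - x) \<le> R" using u v by (simp add: R_def)
      qed
    qed
  qed
  show ?thesis
  proof (rule dominated_measure_has_square_integrable_density[where g="\<lambda>u. ennreal R * G u"])
    show "finite_measure circle_measure"
      by (rule finite_measureI)
        (simp add: sets_eq_imp_space_eq[OF sets_circle_measure] space_restrict_space emeasure_circle_measure)
    show "sets (radial_pushforward x (lam \<Otimes>\<^sub>M lam)) = sets circle_measure"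
      by (simp add: sets_circle_measure)
    have G_circle: "G \<in> borel_measurable (restrict_space borel (sphere 0 1))"
      by (rule measurable_restrict_space1) measurable
    then show "(\<lambda>u. ennreal R * G u) \<in> borel_measurable circle_measure"
      by (simp cong: measurable_cong_sets add: sets_circle_measure)
    show "emeasure (radial_pushforward x (lam \<Otimes>\<^sub>M lam)) B \<le> (\<integral>\<^sup>+u. ennreal R * G u * indicator B u \<partial>circle_measure)"
      if "B \<in> sets circle_measure" for B
    proof (rule radial_pushforward_le[OF Q _ _ \<open>0 < R\<close> bdd _ _ G1])
      show "emeasure (lam \<Otimes>\<^sub>M lam) {y. \<bar>cos t * (snd y - snd x) - sin t * (fst y - fst x)\<bar> \<le> r} \<le>
          ennreal r * G (circle_point t)" if "0 < r" for t r
        using emeasure_strip_le[OF real_distribution_axioms that]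
        by (simp add: G_def line_integral_def \<psi>_def)
    qed (use that in \<open>auto simp: sets_circle_measure\<close>)
    have "(\<integral>\<^sup>+u. (ennreal R * G u)\<^sup>2 \<partial>circle_measure) =
        (\<integral>\<^sup>+t. (ennreal R)\<^sup>2 * ((G (circle_point t))\<^sup>2 * indicator {0..<2 * pi} t) \<partial>lborel)"
      using G_circle by (subst nn_integral_circle_measure) (auto simp: power_mult_distrib mult.assoc)
    also have "\<dots> = (ennreal R)\<^sup>2 * (\<integral>\<^sup>+t. (G (circle_point t))\<^sup>2 * indicator {0..<2 * pi} t \<partial>lborel)"
      by (rule nn_integral_cmult) measurable
    also have "\<dots> \<le> (ennreal R)\<^sup>2 * (\<integral>\<^sup>+t. (G (circle_point t))\<^sup>2 * indicator {- (pi / 4)..9 * pi / 4} t \<partial>lborel)"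
      by (intro mult_left_mono nn_integral_mono) (auto split: split_indicator)
    also have "\<dots> < \<infinity>"
      using G2 \<open>0 < R\<close> by (simp add: ennreal_mult_less_top ennreal_power)
    finally show "(\<integral>\<^sup>+u. (ennreal R * G u)\<^sup>2 \<partial>circle_measure) < \<infinity>" .
  qed
qed

text \<open>With \<open>p = 10 ^ (5 * n)\<close> and \<open>N = 10 ^ (4 * n)\<close> the growth rate is \<open>10 ^ n\<close> up to a factor linear in \<open>n\<close>,
and its cube is about \<open>10 ^ (3 * n)\<close>.\<close>

lemma digit_base_condition:
  fixes n :: nat
  assumes "(6 + 200 * real n) ^ 3 < 100 ^ n"
  shows "(2 + 4 * (real (10 ^ (5 * n)) / real (10 ^ (4 * n))) * (1 + ln (real (10 ^ (5 * n))))) ^ 3 < real (10 ^ (5 * n))"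
proof -
  have ln10: "ln 10 \<le> (10 :: real)"
    using ln_le_minus_one[of "10 :: real"] by simp
  have "real (10 ^ (5 * n)) / real (10 ^ (4 * n)) = 10 ^ n"
  proof -
    have "(10 :: real) ^ (5 * n) = 10 ^ n * 10 ^ (4 * n)"
      by (simp flip: power_add)
    then show ?thesis by simp
  qed
  moreover have "ln (real (10 ^ (5 * n))) = 5 * real n * ln 10"
    by (simp add: ln_realpow)
  moreover have "5 * real n * ln 10 \<le> 5 * real n * 10"
    using ln10 by (intro mult_left_mono) auto
  ultimately have "4 * (real (10 ^ (5 * n)) / real (10 ^ (4 * n))) * (1 + ln (real (10 ^ (5 * n)))) \<le>
      4 * 10 ^ n * (1 + 50 * real n)"
    by simp
  moreover have "2 \<le> 2 * (10 :: real) ^ n" by simp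
  ultimately have "2 + 4 * (real (10 ^ (5 * n)) / real (10 ^ (4 * n))) * (1 + ln (real (10 ^ (5 * n)))) \<le>
      2 * 10 ^ n + 4 * 10 ^ n * (1 + 50 * real n)"
    by (rule add_mono[rotated])
  also have "\<dots> = 10 ^ n * (6 + 200 * real n)"
    by (simp add: algebra_simps)
  finally have "(2 + 4 * (real (10 ^ (5 * n)) / real (10 ^ (4 * n))) * (1 + ln (real (10 ^ (5 * n))))) ^ 3 \<le>
      (10 ^ n * (6 + 200 * real n)) ^ 3"
    by (intro power_mono) (auto intro!: add_nonneg_nonneg mult_nonneg_nonneg)
  also have "\<dots> = 10 ^ (3 * n) * (6 + 200 * real n) ^ 3"
    by (simp add: power_mult_distrib mult.commute flip: power_mult)
  also have "\<dots> < 10 ^ (3 * n) * 100 ^ n"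
    using assms by simp
  also have "\<dots> = 10 ^ (3 * n) * (10 ^ 2) ^ n" by simp
  also have "\<dots> = real (10 ^ (5 * n))"
    unfolding power_mult[symmetric] power_add[symmetric] by simp
  finally show ?thesis .
qed

theorem theoremA:
  fixes lam :: "real measure" and x :: "real \<times> real"
  assumes "lam = missing_digits_measure (10 ^ 10000) {1..10 ^ 8000}"
    and "x \<notin> measure_support lam \<times> measure_support lam"
  shows "absolutely_continuous circle_measure (radial_pushforward x (lam \<Otimes>\<^sub>M lam)) \<and>
    (\<exists>f :: real \<times> real \<Rightarrow> real.
        f \<in> borel_measurable circle_measure \<and>
        (\<forall>u. 0 \<le> f u) \<and>
        radial_pushforward x (lam \<Otimes>\<^sub>M lam) = density circle_measure (\<lambda>u. ennreal (f u)) \<and>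
        integrable circle_measure (\<lambda>u. (f u)\<^sup>2))"
proof -
  (* The exponents are multiples of a symbolic n: the powers themselves are far too large to be
     expanded into numerals. *)
  define n :: nat where "n = 2000"
  have "(6 + 200 * real n) ^ 3 < (100 :: real) ^ 9"
    by (simp add: n_def)
  also have "\<dots> \<le> 100 ^ n"
    by (rule power_increasing) (simp_all add: n_def)
  finally have A3: "(6 + 200 * real n) ^ 3 < 100 ^ n" .
  have exps: "(10000 :: nat) = 5 * n" "(8000 :: nat) = 4 * n"
    by (simp_all add: n_def)
  have "0 < n"
    by (simp add: n_def)
  then have "(10 :: nat) ^ 1 \<le> 10 ^ (5 * n)"
    by (intro power_increasing) auto
  then have "2 \<le> (10 :: nat) ^ (5 * n)" by simp
  then show ?thesis
    unfolding assms(1) exps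
    by (rule radial_pushforward_missing_digits_density[OF _ _ digit_base_condition[OF A3]]) simp
qed

end
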